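(* Let $\mathcal A$ be a finite alphabet with $d=\#\mathcal A\ge 2$ elements and let $\pi\in S_0^{\mathcal A}$, $\lambda\in\mathbb R_{>0}^{\mathcal A}$, $\tau\in\Theta^{\mathcal A}(\pi)$. Assume that the translation surface $(\pi,\lambda,\tau)$ has a horizontal saddle connection. Then the backward Rauzy-Veech induction orbit of $(\pi,\lambda,\tau)$ is not $\infty$-complete.
   Context: Let $\mathcal A$ be a finite alphabet, $d=\#\mathcal A\ge2$. $S_0^{\mathcal A}$ is the set of irreducible permutations: pairs $\pi=(\pi_0,\pi_1)$ of bijections $\pi_0,\pi_1:\mathcal A\to\{1,\dots,d\}$ such that, for $1\le k\le d$, $\pi_1\circ\pi_0^{-1}\{1,\dots,k\}=\{1,\dots,k\}$ implies $k=d$. For $\pi\in S_0^{\mathcal A}$, $\Theta^{\mathcal A}(\pi)$ is the set of $\tau\in\mathbb R^{\mathcal A}$ such that $\sum_{\alpha:\pi_0(\alpha)\le k}\tau_\alpha>0$ and $\sum_{\alpha:\pi_1(\alpha)\le k}\tau_\alpha<0$ for every $k\in\{1,\dots,d-1\}$. Translation surface. For $\lambda\in\mathbb R_{>0}^{\mathcal A}$ and $\tau\in\Theta^{\mathcal A}(\pi)$, the triple $(\pi,\lambda,\tau)$ is identified with the following translation surface. In $\mathbb C$ put $a_k=\sum_{\alpha:\pi_0(\alpha)\le k}(\lambda_\alpha+i\tau_\alpha)$ and $b_k=\sum_{\alpha:\pi_1(\alpha)\le k}(\lambda_\alpha+i\tau_\alpha)$, $0\le k\le d$. The polygon of $(\pi,\lambda,\tau)$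 is bounded by the two broken lines with successive vertices $a_0,\dots,a_d$ and $b_0,\dots,b_d$ ($a_0=b_0=0$, $a_d=b_d$). For each $\alpha$ the sides $[a_{\pi_0(\alpha)-1},a_{\pi_0(\alpha)}]$ and $[b_{\pi_1(\alpha)-1},b_{\pi_1(\alpha)}]$ are identified by translation. The set $\Sigma$ of singularities is the image of the vertices (conical singularities as well as marked points). Horizontal saddle connections. The horizontal flow moves every non-singular point rightwards at unit speed. A (horizontal) separatrix is an orbit hitting $\Sigma$: it is rightward if the singularity is hit in negative time and leftward if it is hit in positive time. A horizontal saddle connection is a separatrix that is both rightward and leftward. Rauzy-Veech induction. $\mathbf R(\pi,\lambda,\tau)=(\pi^1,\lambda^1,\tau^1)$ is defined when $\lambda_{\pi_0^{-1}(d)}\ne\lambda_{\pi_1^{-1}(d)}$. If $\lambda_{\pi_0^{-1}(d)}>\lambda_{\pi_1^{-1}(d)}$ ("top" type), set $w=\pi_0^{-1}(d)$, $l=\pi_1^{-1}(d)$, $\pi^1_0=\pi_0$, and obtain $\pi^1_1$ from $\pi_1$ by moving $l$ to the position immediately after $w$ (shifting by one the letters in between). If $\lambda_{\pi_0^{-1}(d)}<\lambda_{\pi_1^{-1}(d)}$ ("bottom" type), set $w=\pi_1^{-1}(d)$, $l=\pi_0^{-1}(d)$, $\pi^1_1=\pi_1$, and obtain $\pi_0^1$ from $\pi_0$ by moving $l$ to the position immediately after $w$. In both cases $\lambda^1_w=\lambda_w-\lambda_l$, $\tau^1_w=\tau_w-\tau_l$, and the other coordinates of $\lambda,\tau$ are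 unchanged. Backward Rauzy-Veech induction. $\mathbf R$ is invertible at triples with $\sum_{\alpha}\tau_\alpha\ne0$: such $(\pi,\lambda,\tau)$ has a unique preimage $\mathbf R^{-1}(\pi,\lambda,\tau)$ among triples with $\pi\in S_0^{\mathcal A}$, $\lambda\in\mathbb R^{\mathcal A}_{>0}$, $\tau\in\Theta^{\mathcal A}(\pi)$. If $\sum_\alpha\tau_\alpha=0$, then $\mathbf R^{-1}$ is not defined and the backward algorithm stops. Write $\mathbf R^{-n}(\pi,\lambda,\tau)=(\pi^{-n},\lambda^{-n},\tau^{-n})$ when defined. The backward winner of $(\pi,\lambda,\tau)$ is $\pi_0^{-1}(d)$ if $\sum_\alpha\tau_\alpha<0$ and $\pi_1^{-1}(d)$ if $\sum_\alpha\tau_\alpha>0$. The backward orbit of $(\pi,\lambda,\tau)$ is $\infty$-complete if $\mathbf R^{-n}(\pi,\lambda,\tau)$ is defined for every $n\in\mathbb N$ and every symbol of $\mathcal A$ is the backward winner of $(\pi^{-n},\lambda^{-n},\tau^{-n})$ for infinitely many $n\ge0$. *)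

theory Defs
  imports "HOL-Analysis.Analysis"
begin

type_synonym 'a perm_pair = "('a \<Rightarrow> nat) \<times> ('a \<Rightarrow> nat)"

definition irreducible_perms :: "'a::finite perm_pair set" where
  "irreducible_perms = {(p0, p1).
     bij_betw p0 UNIV {1..CARD('a)} \<and> bij_betw p1 UNIV {1..CARD('a)} \<and>
     (\<forall>k\<in>{1..CARD('a)}. (p1 \<circ> inv p0) ` {1..k} = {1..k} \<longrightarrow> k = CARD('a))}"

definition Theta :: "'a::finite perm_pair \<Rightarrow> ('a \<Rightarrow> real) set" where
  "Theta \<pi> = {tau. \<forall>k\<in>{1..CARD('a) - 1}.
     (\<Sum>\<alpha> | fst \<pi> \<alpha> \<le> k. tau \<alpha>) > 0 \<and> (\<Sum>\<alpha> | snd \<pi> \<alpha> \<le> k. tau \<alpha>) < 0}"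

(* Triples (\<pi>, \<lambda>, \<tau>). *)
type_synonym 'a triple = "'a perm_pair \<times> ('a \<Rightarrow> real) \<times> ('a \<Rightarrow> real)"

definition admissible :: "'a::finite triple set" where
  "admissible = {(\<pi>, lam, tau).
     \<pi> \<in> irreducible_perms \<and> (\<forall>\<alpha>. lam \<alpha> > 0) \<and> tau \<in> Theta \<pi>}"

definition last_letter :: "('a::finite \<Rightarrow> nat) \<Rightarrow> 'a" where
  "last_letter p = inv p (CARD('a))"


subsection \<open>Rauzy-Veech induction\<close>

definition move_after :: "('a \<Rightarrow> nat) \<Rightarrow> 'a \<Rightarrow> 'a \<Rightarrow> 'a \<Rightarrow> nat" where
  "move_after p l w = (\<lambda>\<alpha>. if \<alpha> = l then p w + 1
     else if p w < p \<alpha> \<and> p \<alpha> < p l then p \<alpha> + 1 else p \<alpha>)"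

definition rauzy :: "'a::finite triple \<Rightarrow> 'a triple option" where
  "rauzy = (\<lambda>((p0, p1), lam, tau).
     let t = last_letter p0; b = last_letter p1 in
     if lam t > lam b then
       Some ((p0, move_after p1 b t), lam(t := lam t - lam b), tau(t := tau t - tau b))
     else if lam t < lam b then
       Some ((move_after p0 t b, p1), lam(b := lam b - lam t), tau(b := tau b - tau t))
     else None)"

definition rauzy_inv :: "'a::finite triple \<Rightarrow> 'a triple option" where
  "rauzy_inv = (\<lambda>(\<pi>, lam, tau).
     if (\<Sum>\<alpha>\<in>UNIV. tau \<alpha>) \<noteq> 0
     then Some (THE E. E \<in> admissible \<and> rauzy E = Some (\<pi>, lam, tau))
     else None)"

primrec backward_iter :: "nat \<Rightarrow> 'a::finite triple \<Rightarrow> 'a triple option" where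
  "backward_iter 0 D = Some D"
| "backward_iter (Suc n) D = Option.bind (backward_iter n D) rauzy_inv"

definition is_backward_winner :: "'a::finite triple \<Rightarrow> 'a \<Rightarrow> bool" where
  "is_backward_winner = (\<lambda>((p0, p1), lam, tau) \<alpha>.
     ((\<Sum>\<beta>\<in>UNIV. tau \<beta>) < 0 \<and> \<alpha> = last_letter p0) \<or>
     ((\<Sum>\<beta>\<in>UNIV. tau \<beta>) > 0 \<and> \<alpha> = last_letter p1))"

definition backward_infinity_complete :: "'a::finite triple \<Rightarrow> bool" where
  "backward_infinity_complete D \<longleftrightarrow>
     (\<forall>n. backward_iter n D \<noteq> None) \<and>
     (\<forall>\<alpha>. infinite {n. \<exists>E. backward_iter n D = Some E \<and> is_backward_winner E \<alpha>})"


subsection \<open>The polygon and its surface\<close>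

definition vertex :: "('a::finite \<Rightarrow> nat) \<Rightarrow> ('a \<Rightarrow> real) \<Rightarrow> ('a \<Rightarrow> real) \<Rightarrow> nat \<Rightarrow> complex" where
  "vertex p lam tau k = (\<Sum>\<alpha> | p \<alpha> \<le> k. Complex (lam \<alpha>) (tau \<alpha>))"

definition side :: "('a::finite \<Rightarrow> nat) \<Rightarrow> ('a \<Rightarrow> real) \<Rightarrow> ('a \<Rightarrow> real) \<Rightarrow> 'a \<Rightarrow> complex set" where
  "side p lam tau \<alpha> = closed_segment (vertex p lam tau (p \<alpha> - 1)) (vertex p lam tau (p \<alpha>))"

definition broken_line :: "('a::finite \<Rightarrow> nat) \<Rightarrow> ('a \<Rightarrow> real) \<Rightarrow> ('a \<Rightarrow> real) \<Rightarrow> complex set" where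
  "broken_line p lam tau = (\<Union>\<alpha>. side p lam tau \<alpha>)"

definition simple_polygon :: "'a::finite triple \<Rightarrow> bool" where
  "simple_polygon = (\<lambda>((p0, p1), lam, tau).
     broken_line p0 lam tau \<inter> broken_line p1 lam tau = {0, vertex p0 lam tau (CARD('a))})"

(* Since lam > 0, both broken lines are graphs over the same interval of the real axis;
   when they meet only at their ends, the region they bound is the set of points between them. *)
definition polygon :: "'a::finite triple \<Rightarrow> complex set" where
  "polygon = (\<lambda>((p0, p1), lam, tau). {z.
     \<exists>u\<in>broken_line p0 lam tau. \<exists>v\<in>broken_line p1 lam tau.
       Re u = Re z \<and> Re v = Re z \<and> Im v \<le> Im z \<and> Im z \<le> Im u})"

definition side_gluing :: "'a::finite triple \<Rightarrow> complex rel" where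
  "side_gluing = (\<lambda>((p0, p1), lam, tau).
     {(z, z + (vertex p1 lam tau (p1 \<alpha> - 1) - vertex p0 lam tau (p0 \<alpha> - 1))) | \<alpha> z.
        z \<in> side p0 lam tau \<alpha>})"

definition glued :: "'a::finite triple \<Rightarrow> complex rel" where
  "glued D = (side_gluing D \<union> (side_gluing D)\<inverse>)\<^sup>*"

definition surface_point :: "'a::finite triple \<Rightarrow> complex \<Rightarrow> complex set" where
  "surface_point D z = glued D `` {z}"

definition surface :: "'a::finite triple \<Rightarrow> complex set set" where
  "surface D = polygon D // glued D"

definition singularities :: "'a::finite triple \<Rightarrow> complex set set" where
  "singularities = (\<lambda>((p0, p1), lam, tau).
     surface_point ((p0, p1), lam, tau) `
       (vertex p0 lam tau ` {0..CARD('a)} \<union> vertex p1 lam tau ` {0..CARD('a)}))"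


subsection \<open>Horizontal saddle connections\<close>

(* Unit-speed rightward motion on the surface during [0, T]. The representatives used just
   after and just before time t may differ: this is how a flow line crosses a side. *)
definition horizontal_line :: "'a::finite triple \<Rightarrow> (real \<Rightarrow> complex set) \<Rightarrow> real \<Rightarrow> bool" where
  "horizontal_line D \<gamma> T \<longleftrightarrow>
     (\<forall>t\<in>{0..<T}. \<exists>z\<in>\<gamma> t. \<exists>\<epsilon>>0. \<forall>s\<in>{0..\<epsilon>}.
        z + of_real s \<in> polygon D \<and> \<gamma> (t + s) = surface_point D (z + of_real s)) \<and>
     (\<forall>t\<in>{0<..T}. \<exists>z\<in>\<gamma> t. \<exists>\<epsilon>>0. \<forall>s\<in>{0..\<epsilon>}.
        z - of_real s \<in> polygon D \<and> \<gamma> (t - s) = surface_point D (z - of_real s))"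

(* The orbit of the non-singular point x hits a singularity in negative time. *)
definition on_rightward_separatrix :: "'a::finite triple \<Rightarrow> complex set \<Rightarrow> bool" where
  "on_rightward_separatrix D x \<longleftrightarrow>
     (\<exists>\<gamma> T. T > 0 \<and> horizontal_line D \<gamma> T \<and> \<gamma> 0 \<in> singularities D \<and>
        (\<forall>t\<in>{0<..T}. \<gamma> t \<notin> singularities D) \<and> \<gamma> T = x)"

(* The orbit of the non-singular point x hits a singularity in positive time. *)
definition on_leftward_separatrix :: "'a::finite triple \<Rightarrow> complex set \<Rightarrow> bool" where
  "on_leftward_separatrix D x \<longleftrightarrow>
     (\<exists>\<gamma> T. T > 0 \<and> horizontal_line D \<gamma> T \<and> \<gamma> 0 = x \<and>
        (\<forall>t\<in>{0..<T}. \<gamma> t \<notin> singularities D) \<and> \<gamma> T \<in> singularities D)"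

definition polygon_saddle_connection :: "'a::finite triple \<Rightarrow> bool" where
  "polygon_saddle_connection D \<longleftrightarrow>
     (\<exists>x\<in>surface D - singularities D.
        on_rightward_separatrix D x \<and> on_leftward_separatrix D x)"

(* The two broken lines of an admissible triple may meet away from their ends, and then do not
   bound a polygon. The translation surface is in that case the one of rauzy D, Rauzy-Veech
   induction being a cut and paste that does not change the surface.
   A simple polygon is always reached. Say the sum S of tau is > 0 (if S = 0 the polygon is
   simple, and S < 0 is symmetric). Before its last side the bottom line is below the real axis,
   and the top line is above it, so a crossing lies on the last bottom side, and forces that
   side to start to the left of the last top side. The next step is therefore of bottom type,
   its winner is the last bottom letter w, which stays last, and S becomes the height of the
   next-to-last top vertex, which is > 0. So while the polygon is not simple each step
   subtracts from lam w the unchanged length of another letter; as lam w stays positive,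
   this ends. *)
inductive represented_by :: "'a::finite triple \<Rightarrow> 'a triple \<Rightarrow> bool" where
  simple: "simple_polygon D \<Longrightarrow> represented_by D D"
| step: "\<not> simple_polygon D \<Longrightarrow> rauzy D = Some E \<Longrightarrow> represented_by E F \<Longrightarrow> represented_by D F"

definition has_horizontal_saddle_connection :: "'a::finite triple \<Rightarrow> bool" where
  "has_horizontal_saddle_connection D \<longleftrightarrow>
     (\<exists>E. represented_by D E \<and> polygon_saddle_connection E)"

end

theory Submission
  imports Defs
begin

text \<open>
  The vertical lines through the vertices decompose the surface into one rectangle per letter
  \<open>\<alpha>\<close>, of width \<open>lam \<alpha>\<close> and of height \<open>roof \<alpha>\<close>, the vertical displacement between the two sides
  named \<open>\<alpha>\<close>. The right edge of a rectangle carries a singularity at the height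
  \<open>rgt p tau \<alpha>\<close> of the right end of its top side. A flow line that leaves the rectangle below
  the singularity enters the rectangle that follows \<open>\<alpha>\<close> in the top order; one that leaves above
  enters the rectangle that follows \<open>\<alpha>\<close> in the bottom order. These moves (\<open>hop\<close>) depend on the
  permutation and on \<open>tau\<close> alone. A flow line that starts at a singularity and reaches another one
  thus becomes a finite nonempty list of letters (\<open>saddle\<close>).

  A backward Rauzy-Veech step with winner \<open>w\<close> and loser \<open>l\<close> cuts from rectangle \<open>l\<close> a piece of
  height \<open>roof w\<close> and glues it to the right of rectangle \<open>w\<close>. Every visit to \<open>w\<close> is therefore
  followed by a visit to that piece of \<open>l\<close>, and in the coding of the same flow line for the new
  data these two letters become the single letter \<open>w\<close>; nothing else changes. So the list becomes
  shorter if it contains the winner and stays the same otherwise (\<open>shorten_saddle\<close>). If the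
  backward orbit is complete, each letter of the list wins sooner or later, and the list would
  have to become shorter infinitely often (\<open>complete_no_saddle\<close>).

  It remains to obtain the coding from a saddle connection on a glued polygon
  (\<open>saddle_connection_coded\<close>). In a simple polygon a point on or above the real axis belongs to
  the rectangle of the top side over it, a point below the axis to that of the bottom side under
  it. Moving right inside the polygon, and passing through a pair of glued sides, then amounts to a
  finite number of hops. One correction is needed: the last bottom side may rise above the axis, or
  the last top side sink below it, and there a point of the polygon can lie beyond the top or the
  bottom of the rectangle assigned to it. The function \<open>carry\<close> replaces it by the
  rectangle in which it arrives at the right end of the base interval.

  Finally, the polygon in question belongs to a forward iterate of the given triple. Forward steps
  are undone by backward steps (\<open>rauzy_admissible\<close>), so completeness of the backward orbit passes to
  that iterate.
\<close>

section \<open>Partial sums along an enumeration of the alphabet\<close>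

definition enumeration :: "('a::finite \<Rightarrow> nat) \<Rightarrow> bool" where
  "enumeration p \<longleftrightarrow> bij_betw p UNIV {1..CARD('a)}"

text \<open>
  Used with \<open>lam\<close> and with \<open>tau\<close>: \<open>lft\<close> and \<open>rgt\<close> are then the coordinates of the left and the
  right end of the side \<open>\<alpha>\<close> in the broken line ordered by \<open>p\<close>.
\<close>

definition lft :: "('a::finite \<Rightarrow> nat) \<Rightarrow> ('a \<Rightarrow> real) \<Rightarrow> 'a \<Rightarrow> real" where
  "lft p f \<alpha> = (\<Sum>\<beta> | p \<beta> < p \<alpha>. f \<beta>)"

definition rgt :: "('a::finite \<Rightarrow> nat) \<Rightarrow> ('a \<Rightarrow> real) \<Rightarrow> 'a \<Rightarrow> real" where
  "rgt p f \<alpha> = lft p f \<alpha> + f \<alpha>"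

lemma enumeration_eq_iff: "enumeration p \<Longrightarrow> p \<alpha> = p \<beta> \<longleftrightarrow> \<alpha> = \<beta>"
  unfolding enumeration_def bij_betw_def by (auto dest: injD)

lemma enumeration_bounds:
  fixes p :: "'a::finite \<Rightarrow> nat"
  assumes "enumeration p"
  shows "1 \<le> p \<alpha>" "p \<alpha> \<le> CARD('a)"
  using assms unfolding enumeration_def bij_betw_def by auto

lemma enumeration_ex:
  fixes p :: "'a::finite \<Rightarrow> nat"
  assumes "enumeration p" "1 \<le> k" "k \<le> CARD('a)"
  obtains \<alpha> where "p \<alpha> = k"
  using assms unfolding enumeration_def bij_betw_def by (metis atLeastAtMost_iff imageE)

lemma enumeration_last_iff:
  fixes p :: "'a::finite \<Rightarrow> nat"
  assumes "enumeration p"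
  shows "p \<alpha> = CARD('a) \<longleftrightarrow> \<alpha> = last_letter p"
proof -
  have "inj p" using assms by (simp add: enumeration_def bij_betw_def)
  moreover obtain \<beta> where "p \<beta> = CARD('a)" using enumeration_ex[OF assms, of "CARD('a)"]
    by (metis One_nat_def Suc_leI order_refl zero_less_card_finite)
  ultimately show ?thesis unfolding last_letter_def by (metis inv_f_f)
qed

lemma enumeration_less_iff_le: "enumeration p \<Longrightarrow> p \<beta> \<le> p \<alpha> \<longleftrightarrow> p \<beta> < p \<alpha> \<or> \<beta> = \<alpha>"
  by (auto simp: le_less enumeration_eq_iff)

lemma rgt_eq_sum:
  assumes "enumeration p"
  shows "rgt p f \<alpha> = (\<Sum>\<beta> | p \<beta> \<le> p \<alpha>. f \<beta>)"
proof -
  have "{\<beta>. p \<beta> \<le> p \<alpha>} = insert \<alpha> {\<beta>. p \<beta> < p \<alpha>}"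
    using enumeration_less_iff_le[OF assms] by auto
  then show ?thesis by (simp add: rgt_def lft_def)
qed

lemma lft_succ:
  assumes "enumeration p" "p \<beta> = Suc (p \<alpha>)"
  shows "lft p f \<beta> = rgt p f \<alpha>"
  unfolding rgt_eq_sum[OF assms(1)] lft_def assms(2) less_Suc_eq_le ..

lemma lft_first:
  assumes "enumeration p" "p \<alpha> = 1"
  shows "lft p f \<alpha> = 0"
proof -
  have "{\<beta>. p \<beta> < p \<alpha>} = {}"
    using enumeration_bounds(1)[OF assms(1)] unfolding assms(2) by (auto simp: not_less[symmetric])
  then show ?thesis by (simp add: lft_def)
qed

lemma rgt_last:
  fixes p :: "'a::finite \<Rightarrow> nat"
  assumes "enumeration p" "p \<alpha> = CARD('a)"
  shows "rgt p f \<alpha> = sum f UNIV"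
  using enumeration_bounds(2)[OF assms(1)] by (simp add: rgt_eq_sum assms)

lemma enumeration_succ:
  fixes p :: "'a::finite \<Rightarrow> nat"
  assumes "enumeration p" "p \<alpha> < CARD('a)"
  obtains \<beta> where "p \<beta> = Suc (p \<alpha>)"
  using enumeration_ex[OF assms(1), of "Suc (p \<alpha>)"] assms(2) by auto

lemma enumeration_pred:
  fixes p :: "'a::finite \<Rightarrow> nat"
  assumes "enumeration p" "p \<alpha> \<noteq> 1"
  obtains \<beta> where "p \<alpha> = Suc (p \<beta>)"
proof -
  have "1 \<le> p \<alpha> - 1" "p \<alpha> - 1 \<le> CARD('a)"
    using assms enumeration_bounds[OF assms(1), of \<alpha>] by auto
  from enumeration_ex[OF assms(1) this] obtain \<beta> where "p \<beta> = p \<alpha> - 1" .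
  then show ?thesis using that[of \<beta>] enumeration_bounds(1)[OF assms(1), of \<alpha>] by auto
qed

lemma enumeration_of_inj_bounded:
  fixes p :: "'a::finite \<Rightarrow> nat"
  assumes "inj p" "\<And>\<alpha>. 1 \<le> p \<alpha>" "\<And>\<alpha>. p \<alpha> \<le> CARD('a)"
  shows "enumeration p"
proof -
  have "p ` UNIV \<subseteq> {1..CARD('a)}" using assms by auto
  moreover have "card (p ` UNIV) = card {1..CARD('a)}" using assms(1) by (simp add: card_image)
  ultimately have "p ` UNIV = {1..CARD('a)}" by (simp add: card_subset_eq)
  then show ?thesis using assms(1) by (simp add: enumeration_def bij_betw_def)
qed

section \<open>Moving the last letter\<close>

lemma move_after_last:
  fixes q :: "'a::finite \<Rightarrow> nat"
  assumes "enumeration q" "q l = CARD('a)" "w \<noteq> l"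
  shows "move_after q l w \<alpha> = (if \<alpha> = l then Suc (q w) else if q w < q \<alpha> then Suc (q \<alpha>) else q \<alpha>)"
proof -
  have "\<alpha> \<noteq> l \<Longrightarrow> q \<alpha> < q l"
    using enumeration_bounds(2)[OF assms(1), of \<alpha>] assms enumeration_eq_iff[OF assms(1), of \<alpha> l]
    by linarith
  then show ?thesis by (auto simp: move_after_def)
qed

context
  fixes q q' :: "'a::finite \<Rightarrow> nat" and l w :: 'a
  assumes ord': "enumeration q'" and l': "q' l = CARD('a)" and wl: "w \<noteq> l"
    and q: "q = move_after q' l w"
begin

lemma move_val: "q \<alpha> = (if \<alpha> = l then Suc (q' w) else if q' w < q' \<alpha> then Suc (q' \<alpha>) else q' \<alpha>)"
  unfolding q using move_after_last[OF ord' l' wl] .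

lemma move_less: "\<alpha> \<noteq> l \<Longrightarrow> q' \<alpha> < CARD('a)"
  using enumeration_bounds(2)[OF ord', of \<alpha>] l' enumeration_eq_iff[OF ord', of \<alpha> l] by linarith

lemma move_enumeration: "enumeration q"
proof (rule enumeration_of_inj_bounded)
  show "inj q"
    by (rule injI) (use enumeration_eq_iff[OF ord'] wl in \<open>auto simp: move_val split: if_splits\<close>)
  fix \<alpha>
  show "1 \<le> q \<alpha>" using enumeration_bounds(1)[OF ord', of \<alpha>] by (auto simp: move_val)
  show "q \<alpha> \<le> CARD('a)" using move_less[of \<alpha>] move_less[of w] wl by (auto simp: move_val)
qed

lemma move_succ:
  assumes "q \<beta> = Suc (q \<alpha>)"
  shows "\<alpha> = w \<and> \<beta> = l \<or> \<alpha> = l \<and> \<beta> \<noteq> l \<and> q' \<beta> = Suc (q' w)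
    \<or> \<alpha> \<noteq> w \<and> \<alpha> \<noteq> l \<and> \<beta> \<noteq> l \<and> q' \<beta> = Suc (q' \<alpha>)"
  using assms wl enumeration_eq_iff[OF ord'] by (auto simp: move_val split: if_splits)

lemma move_at_end:
  assumes "q \<alpha> = CARD('a)"
  shows "\<alpha> \<noteq> w \<and> Suc (q' (if \<alpha> = l then w else \<alpha>)) = CARD('a)"
  using assms wl move_less[of \<alpha>] move_less[of w] by (auto simp: move_val split: if_splits)

lemma move_w: "q l = Suc (q w)"
  using wl by (simp add: move_val)

text \<open>
  The letter that is moved next to \<open>w\<close> contributes exactly what \<open>w\<close> loses, so the sides keep their
  left ends. Only the moved side starts at a new point, the former right end of \<open>w\<close> shifted back along
  side \<open>l\<close>.
\<close>

lemma lft_move: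
  "lft q (f(w := f w - f l)) \<alpha> = (if \<alpha> = l then rgt q' f w - f l else lft q' f \<alpha>)"
proof -
  let ?g = "f(w := f w - f l)"
  have g: "sum ?g A = sum f A" if "w \<notin> A" for A
    using that by (intro sum.cong) auto
  have gw: "sum ?g A = sum f A - f l" if "w \<in> A" for A
    using that by (simp add: sum.remove[of A w] g)
  show ?thesis
  proof (cases "\<alpha> = l")
    case True
    have "{\<beta>. q \<beta> < q l} = {\<beta>. q' \<beta> \<le> q' w}"
      using move_less[OF wl] by (auto simp: move_val l' split: if_splits)
    then show ?thesis using True by (simp add: lft_def rgt_eq_sum[OF ord'] gw del: fun_upd_apply)
  next
    case nl: False
    show ?thesis
    proof (cases "q' w < q' \<alpha>")
      case True
      have "{\<beta>. q \<beta> < q \<alpha>} = insert l {\<beta>. q' \<beta> < q' \<alpha>}" "l \<notin> {\<beta>. q' \<beta> < q' \<alpha>}"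
        using True nl move_less[OF nl] by (auto simp: move_val l' split: if_splits)
      then show ?thesis using True nl wl gw[of "{\<beta>. q' \<beta> < q' \<alpha>}"]
        by (simp add: lft_def)
    next
      case False
      have "{\<beta>. q \<beta> < q \<alpha>} = {\<beta>. q' \<beta> < q' \<alpha>}"
        using False nl move_less[OF nl] by (auto simp: move_val l' split: if_splits)
      then show ?thesis using False nl g[of "{\<beta>. q' \<beta> < q' \<alpha>}"] by (simp add: lft_def)
    qed
  qed
qed

end

lemma lft_upd_last:
  fixes p :: "'a::finite \<Rightarrow> nat"
  assumes "enumeration p" "p w = CARD('a)"
  shows "lft p (f(w := c)) \<alpha> = lft p f \<alpha>"
  unfolding lft_def using enumeration_bounds(2)[OF assms(1), of \<alpha>] assms(2) by (intro sum.cong) auto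

text \<open>
  The inverse of \<open>move_after\<close>, by which the order before a Rauzy step is recovered from the order
  after it.
\<close>

definition move_to_end :: "('a::finite \<Rightarrow> nat) \<Rightarrow> 'a \<Rightarrow> 'a \<Rightarrow> nat" where
  "move_to_end q l = (\<lambda>\<alpha>. if \<alpha> = l then CARD('a) else if q l < q \<alpha> then q \<alpha> - 1 else q \<alpha>)"

lemma move_to_end_move_after:
  fixes q :: "'a::finite \<Rightarrow> nat"
  assumes "enumeration q" "q l = CARD('a)" "w \<noteq> l"
  shows "move_to_end (move_after q l w) l = q"
proof
  fix \<alpha>
  show "move_to_end (move_after q l w) l \<alpha> = q \<alpha>"
    unfolding move_to_end_def move_after_last[OF assms] using assms by auto
qed

lemma move_to_end_inverse:
  fixes q :: "'a::finite \<Rightarrow> nat"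
  assumes "enumeration q" "q l = Suc (q w)"
  shows "enumeration (move_to_end q l)" "move_to_end q l l = CARD('a)" "w \<noteq> l"
    "move_after (move_to_end q l) l w = q"
proof -
  show wl: "w \<noteq> l" and atend: "move_to_end q l l = CARD('a)"
    using assms(2) by (auto simp: move_to_end_def)
  note b = enumeration_bounds[OF assms(1)] and e = enumeration_eq_iff[OF assms(1)]
  show o: "enumeration (move_to_end q l)"
  proof (rule enumeration_of_inj_bounded)
    show "inj (move_to_end q l)"
    proof (rule injI)
      fix x y assume xy: "move_to_end q l x = move_to_end q l y"
      have "q x = q l \<longleftrightarrow> x = l" "q y = q l \<longleftrightarrow> y = l" using e by auto
      then have "q x = q y" using xy b[of x] b[of y] b[of l]
        unfolding move_to_end_def by (auto split: if_splits)
      then show "x = y" using e by simp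
    qed
    fix \<alpha>
    show "1 \<le> move_to_end q l \<alpha>" using b[of \<alpha>] b[of l] by (auto simp: move_to_end_def)
    show "move_to_end q l \<alpha> \<le> CARD('a)" using b[of \<alpha>] by (auto simp: move_to_end_def)
  qed
  show "move_after (move_to_end q l) l w = q"
  proof
    fix \<alpha>
    have "q \<alpha> = q l \<longleftrightarrow> \<alpha> = l" using e by auto
    then show "move_after (move_to_end q l) l w \<alpha> = q \<alpha>"
      unfolding move_after_last[OF o atend wl] using assms(2) wl by (auto simp: move_to_end_def)
  qed
qed

section \<open>Suspension data\<close>

text \<open>
  The condition on \<open>tau\<close> is stated letter by letter. It forces the pair of orders to be irreducible:
  if the first \<open>k < d\<close> letters of both orders were the same set, the sum of \<open>tau\<close> over it would be
  both positive and negative. Hence irreducibility need not be carried through the induction.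
\<close>

locale suspension =
  fixes p q :: "'a::finite \<Rightarrow> nat" and tau :: "'a \<Rightarrow> real"
  assumes two: "2 \<le> CARD('a)"
    and ord_p: "enumeration p" and ord_q: "enumeration q"
    and above: "\<And>\<alpha>. p \<alpha> < CARD('a) \<Longrightarrow> 0 < rgt p tau \<alpha>"
    and below: "\<And>\<alpha>. q \<alpha> < CARD('a) \<Longrightarrow> rgt q tau \<alpha> < 0"
begin

lemma lft_p: "p \<alpha> \<noteq> 1 \<Longrightarrow> 0 < lft p tau \<alpha>" "0 \<le> lft p tau \<alpha>"
proof -
  show *: "0 < lft p tau \<alpha>" if "p \<alpha> \<noteq> 1"
  proof -
    obtain \<beta> where "p \<alpha> = Suc (p \<beta>)" by (rule enumeration_pred[OF ord_p \<open>p \<alpha> \<noteq> 1\<close>])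
    then show ?thesis
      using above[of \<beta>] lft_succ[OF ord_p, of \<alpha> \<beta> tau] enumeration_bounds(2)[OF ord_p, of \<alpha>] by simp
  qed
  show "0 \<le> lft p tau \<alpha>"
    using * lft_first[OF ord_p, of \<alpha> tau] by (cases "p \<alpha> = 1") (simp_all add: less_imp_le)
qed

lemma lft_q: "q \<alpha> \<noteq> 1 \<Longrightarrow> lft q tau \<alpha> < 0" "lft q tau \<alpha> \<le> 0"
proof -
  show *: "lft q tau \<alpha> < 0" if "q \<alpha> \<noteq> 1"
  proof -
    obtain \<beta> where "q \<alpha> = Suc (q \<beta>)" by (rule enumeration_pred[OF ord_q \<open>q \<alpha> \<noteq> 1\<close>])
    then show ?thesis
      using below[of \<beta>] lft_succ[OF ord_q, of \<alpha> \<beta> tau] enumeration_bounds(2)[OF ord_q, of \<alpha>] by simp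
  qed
  show "lft q tau \<alpha> \<le> 0"
    using * lft_first[OF ord_q, of \<alpha> tau] by (cases "q \<alpha> = 1") (simp_all add: less_imp_le)
qed

lemma not_both_first: "\<not> (p \<alpha> = 1 \<and> q \<alpha> = 1)"
  using above[of \<alpha>] below[of \<alpha>] two lft_first[OF ord_p, of \<alpha> tau] lft_first[OF ord_q, of \<alpha> tau]
  by (auto simp: rgt_def)

lemma not_both_last: "\<not> (p \<alpha> = CARD('a) \<and> q \<alpha> = CARD('a))"
  using rgt_last[OF ord_p, of \<alpha> tau] rgt_last[OF ord_q, of \<alpha> tau] lft_p(1)[of \<alpha>] lft_q(1)[of \<alpha>] two
  by (auto simp: rgt_def)

text \<open>
  Both sides named \<open>\<alpha>\<close> rise by \<open>tau \<alpha>\<close>, so their left ends and their right ends have the same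
  vertical distance (\<open>roof_rgt\<close>).
\<close>

definition roof :: "'a \<Rightarrow> real" where
  "roof \<alpha> = lft p tau \<alpha> - lft q tau \<alpha>"

lemma roof_rgt: "roof \<alpha> = rgt p tau \<alpha> - rgt q tau \<alpha>"
  by (simp add: roof_def rgt_def)

lemma roof_pos: "0 < roof \<alpha>"
  using not_both_first[of \<alpha>] lft_p[of \<alpha>] lft_q[of \<alpha>] unfolding roof_def by linarith

end

lemma Theta_iff:
  fixes p q :: "'a::finite \<Rightarrow> nat"
  assumes "enumeration p" "enumeration q"
  shows "tau \<in> Theta (p, q) \<longleftrightarrow> (\<forall>\<alpha>. p \<alpha> < CARD('a) \<longrightarrow> 0 < rgt p tau \<alpha>)
    \<and> (\<forall>\<alpha>. q \<alpha> < CARD('a) \<longrightarrow> rgt q tau \<alpha> < 0)"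
proof -
  have *: "(\<forall>k\<in>{1..CARD('a) - 1}. Q (\<Sum>\<alpha> | r \<alpha> \<le> k. tau \<alpha>))
      \<longleftrightarrow> (\<forall>\<alpha>. r \<alpha> < CARD('a) \<longrightarrow> Q (rgt r tau \<alpha>))" (is "?L \<longleftrightarrow> ?R")
    if r: "enumeration r" for Q and r :: "'a \<Rightarrow> nat"
  proof
    assume L: ?L
    show ?R
    proof (intro allI impI)
      fix \<alpha> assume "r \<alpha> < CARD('a)"
      then have "r \<alpha> \<in> {1..CARD('a) - 1}" using enumeration_bounds(1)[OF r, of \<alpha>] by auto
      then show "Q (rgt r tau \<alpha>)" using L by (simp add: rgt_eq_sum[OF r])
    qed
  next
    assume R: ?R
    show ?L
    proof
      fix k assume k: "k \<in> {1..CARD('a) - 1}"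
      then have "1 \<le> k" "k \<le> CARD('a)" by auto
      then obtain \<alpha> where a: "r \<alpha> = k" by (rule enumeration_ex[OF r])
      then have "r \<alpha> < CARD('a)" using k by auto
      then show "Q (\<Sum>\<alpha> | r \<alpha> \<le> k. tau \<alpha>)" using R a by (auto simp: rgt_eq_sum[OF r])
    qed
  qed
  have "tau \<in> Theta (p, q) \<longleftrightarrow> (\<forall>k\<in>{1..CARD('a) - 1}. 0 < (\<Sum>\<alpha> | p \<alpha> \<le> k. tau \<alpha>))
      \<and> (\<forall>k\<in>{1..CARD('a) - 1}. (\<Sum>\<alpha> | q \<alpha> \<le> k. tau \<alpha>) < 0)"
    unfolding Theta_def by auto
  then show ?thesis
    unfolding *[OF assms(1), of "\<lambda>x. 0 < x"] *[OF assms(2), of "\<lambda>x. x < 0"] .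
qed

lemma enumeration_image_initial:
  fixes p :: "'a::finite \<Rightarrow> nat"
  assumes "enumeration p" "k \<le> CARD('a)"
  shows "p ` {\<alpha>. p \<alpha> \<le> k} = {1..k}"
proof
  show "p ` {\<alpha>. p \<alpha> \<le> k} \<subseteq> {1..k}"
    using enumeration_bounds(1)[OF assms(1)] by auto
  show "{1..k} \<subseteq> p ` {\<alpha>. p \<alpha> \<le> k}"
  proof
    fix j assume j: "j \<in> {1..k}"
    then have "1 \<le> j" "j \<le> CARD('a)" using assms(2) by auto
    then obtain \<alpha> where "p \<alpha> = j" by (rule enumeration_ex[OF assms(1)])
    then show "j \<in> p ` {\<alpha>. p \<alpha> \<le> k}" using j by auto
  qed
qed

lemma (in suspension) irreducible: "(p, q) \<in> irreducible_perms"
  unfolding irreducible_perms_def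
proof (simp add: comp_def del: One_nat_def, intro conjI)
  show "bij_betw p UNIV {1..CARD('a)}" "bij_betw q UNIV {1..CARD('a)}"
    using ord_p ord_q by (simp_all add: enumeration_def)
  show "\<forall>k\<in>{1..CARD('a)}. (\<lambda>x. q (inv p x)) ` {1..k} = {1..k} \<longrightarrow> k = CARD('a)"
  proof (intro ballI impI, rule ccontr)
    fix k assume k: "k \<in> {1..CARD('a)}" and img: "(\<lambda>x. q (inv p x)) ` {1..k} = {1..k}"
      and "k \<noteq> CARD('a)"
    then have kd: "k < CARD('a)" by simp
    have inj: "inj p" "inj q" using ord_p ord_q by (auto simp: enumeration_def bij_betw_def)
    have "p ` {\<alpha>. p \<alpha> \<le> k} = {1..k}"
      using enumeration_image_initial[OF ord_p] kd by simp
    then have "{1..k} = q ` (inv p ` p ` {\<alpha>. p \<alpha> \<le> k})" using img by (simp add: image_image)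
    also have "\<dots> = q ` {\<alpha>. p \<alpha> \<le> k}" by (simp add: image_image inj)
    finally have "q ` {\<alpha>. p \<alpha> \<le> k} = {1..k}" by simp
    moreover have "q ` {\<alpha>. q \<alpha> \<le> k} = {1..k}"
      using enumeration_image_initial[OF ord_q] kd by simp
    ultimately have eq: "{\<alpha>. p \<alpha> \<le> k} = {\<alpha>. q \<alpha> \<le> k}"
      using inj(2) by (metis inj_image_eq_iff)
    have k1: "1 \<le> k" and k2: "k \<le> CARD('a)" using k by auto
    obtain \<alpha> where "p \<alpha> = k" by (rule enumeration_ex[OF ord_p k1 k2])
    moreover obtain \<beta> where "q \<beta> = k" by (rule enumeration_ex[OF ord_q k1 k2])
    ultimately    show False
      using above[of \<alpha>] below[of \<beta>] kd eq by (simp add: rgt_eq_sum ord_p ord_q)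
  qed
qed

lemma admissible_iff:
  fixes p q :: "'a::finite \<Rightarrow> nat"
  assumes "2 \<le> CARD('a)"
  shows "((p, q), lam, tau) \<in> admissible \<longleftrightarrow> suspension p q tau \<and> (\<forall>\<alpha>. 0 < lam \<alpha>)"
proof
  assume a: "((p, q), lam, tau) \<in> admissible"
  then have o: "enumeration p" "enumeration q"
    by (auto simp: admissible_def irreducible_perms_def enumeration_def)
  show "suspension p q tau \<and> (\<forall>\<alpha>. 0 < lam \<alpha>)"
    using a o assms by (auto simp: admissible_def suspension_def Theta_iff)
next
  assume a: "suspension p q tau \<and> (\<forall>\<alpha>. 0 < lam \<alpha>)"
  then interpret suspension p q tau by simp
  show "((p, q), lam, tau) \<in> admissible"
    using a irreducible above below by (simp add: admissible_def Theta_iff[OF ord_p ord_q])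
qed

section \<open>Coded saddle connections\<close>

context suspension
begin

text \<open>
  A state \<open>(\<alpha>, y)\<close> is a point of rectangle \<open>\<alpha>\<close> at height \<open>y\<close> over its base. Measured from the top
  of the rectangle the height is \<open>y - roof \<alpha>\<close>, and this value is kept by a hop in the bottom order.
  The two remaining rules concern the right end of the base interval. At the end of the top order,
  at a height below the last vertex, the edge is glued to the right edge of the last rectangle
  \<open>\<omega>\<close> of the bottom order, above its roof: the flow line continues as from \<open>(\<omega>, y + roof \<omega>)\<close>. At the
  end of the bottom order the picture is turned upside down.
\<close>

inductive hop :: "'a \<times> real \<Rightarrow> 'a \<times> real \<Rightarrow> bool" where
  under: "p \<beta> = Suc (p \<alpha>) \<Longrightarrow> y < rgt p tau \<alpha> \<Longrightarrow> hop (\<alpha>, y) (\<beta>, y)"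
| over: "q \<beta> = Suc (q \<alpha>) \<Longrightarrow> rgt p tau \<alpha> < y \<Longrightarrow> hop (\<alpha>, y) (\<beta>, y - roof \<alpha> + roof \<beta>)"
| under_wrap: "p \<alpha> = CARD('a) \<Longrightarrow> q \<omega> = CARD('a) \<Longrightarrow> p \<beta> = Suc (p \<omega>) \<Longrightarrow> y < rgt p tau \<alpha>
    \<Longrightarrow> hop (\<alpha>, y) (\<beta>, y + roof \<omega>)"
| over_wrap: "q \<alpha> = CARD('a) \<Longrightarrow> p \<omega> = CARD('a) \<Longrightarrow> q \<beta> = Suc (q \<omega>) \<Longrightarrow> rgt p tau \<alpha> < y
    \<Longrightarrow> hop (\<alpha>, y) (\<beta>, y - roof \<alpha> - roof \<omega> + roof \<beta>)"

text \<open>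
  The letters are listed with the most recent one first. The starting height is that of the
  singularity on the left edge. The strict inequality excludes the start on the roof, which occurs
  only if \<open>\<alpha>\<close> is first in the bottom order; that flow line issues from the left end of the base
  interval and is also coded by the first letter of the top order, at height \<open>0\<close>.
\<close>

inductive trajectory :: "'a list \<Rightarrow> 'a \<times> real \<Rightarrow> bool" where
  start: "lft p tau \<alpha> < roof \<alpha> \<Longrightarrow> trajectory [\<alpha>] (\<alpha>, lft p tau \<alpha>)"
| hop: "trajectory as s \<Longrightarrow> hop s s' \<Longrightarrow> trajectory (fst s' # as) s'"

definition saddle :: "'a list \<Rightarrow> bool" where
  "saddle as \<longleftrightarrow> (\<exists>\<alpha>. trajectory as (\<alpha>, rgt p tau \<alpha>))"

lemma roof_last_q: "q \<omega> = CARD('a) \<Longrightarrow> p \<alpha> = CARD('a) \<Longrightarrow> rgt p tau \<omega> = roof \<omega> + rgt p tau \<alpha>"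
  by (simp add: roof_rgt rgt_last[OF ord_p] rgt_last[OF ord_q])

text \<open>
  All heights stay in the half-open interval from \<open>0\<close> to the roof. A point on a horizontal edge of
  the rectangles thus has only one code.
\<close>

lemma hop_range:
  assumes "hop s s'" "0 \<le> snd s" "snd s < roof (fst s)"
  shows "0 \<le> snd s' \<and> snd s' < roof (fst s')"
  using assms
proof (cases rule: hop.cases)
  case (under \<beta> \<alpha> y)
  then show ?thesis
    using assms lft_succ[OF ord_p, of \<beta> \<alpha> tau] lft_q(2)[of \<beta>] by (simp add: roof_def)
next
  case (over \<beta> \<alpha> y)
  then show ?thesis
    using assms lft_succ[OF ord_q, of \<beta> \<alpha> tau] lft_p(2)[of \<beta>] roof_rgt[of \<alpha>] by (simp add: roof_def)
next
  case (under_wrap \<alpha> \<omega> \<beta> y)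
  then show ?thesis
    using assms lft_succ[OF ord_p, of \<beta> \<omega> tau] lft_q(2)[of \<beta>] roof_pos[of \<omega>]
      roof_last_q[of \<omega> \<alpha>] roof_def[of \<beta>] by simp
next
  case (over_wrap \<alpha> \<omega> \<beta> y)
  then show ?thesis
    using assms lft_succ[OF ord_q, of \<beta> \<omega> tau] lft_p(2)[of \<beta>] roof_pos[of \<omega>]
      roof_last_q[of \<alpha> \<omega>] roof_def[of \<beta>] roof_rgt[of \<omega>] by simp
qed

lemma trajectory_range:
  assumes "trajectory as s"
  shows "0 \<le> snd s \<and> snd s < roof (fst s)"
  using assms by induction (use lft_p(2) hop_range in auto)

lemma trajectory_fst: "trajectory as s \<Longrightarrow> as \<noteq> [] \<and> hd as = fst s"
  by (induction rule: trajectory.induct) auto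

end

section \<open>Backward steps of top type\<close>

text \<open>
  The primed data are those before a Rauzy step, that is, those which the backward step recovers;
  \<open>w\<close> is the winner and \<open>l\<close> the loser.
\<close>

locale top_step = old: suspension p q' tau'
  for p q' :: "'a::finite \<Rightarrow> nat" and tau' :: "'a \<Rightarrow> real" +
  fixes q :: "'a \<Rightarrow> nat" and tau :: "'a \<Rightarrow> real" and w l :: 'a
  assumes w: "p w = CARD('a)" and l: "q' l = CARD('a)"
    and q: "q = move_after q' l w" and tau: "tau = tau'(w := tau' w - tau' l)"
begin

lemma wl: "w \<noteq> l"
  using old.not_both_last w l by auto

lemmas move = old.ord_q l wl q

lemma lft_p: "lft p tau \<alpha> = lft p tau' \<alpha>"
  unfolding tau by (rule lft_upd_last[OF old.ord_p w])

lemma lft_q: "lft q tau \<alpha> = (if \<alpha> = l then rgt q' tau' w - tau' l else lft q' tau' \<alpha>)"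
  unfolding tau by (rule lft_move[OF move])

lemma tau_val: "tau \<alpha> = (if \<alpha> = w then tau' w - tau' l else tau' \<alpha>)"
  by (simp add: tau)

lemma total: "rgt p tau w = lft q' tau' l" "rgt p tau' w = rgt q' tau' l"
proof -
  show *: "rgt p tau' w = rgt q' tau' l"
    by (simp add: rgt_last[OF old.ord_p w] rgt_last[OF old.ord_q l])
  show "rgt p tau w = lft q' tau' l"
    using * by (simp add: rgt_def lft_p tau_val)
qed

lemma total_neg: "rgt p tau w < 0"
  using old.lft_q(1)[of l] l old.two by (simp add: total)

lemma rgt_p: "rgt p tau \<alpha> = (if \<alpha> = w then lft q' tau' l else rgt p tau' \<alpha>)"
  using total by (simp add: rgt_def lft_p tau_val)

lemma rgt_q: "rgt q tau \<alpha> = (if \<alpha> = l then rgt q' tau' w else if \<alpha> = w then rgt q' tau' w - tau' l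
   else rgt q' tau' \<alpha>)"
  using wl by (simp add: rgt_def lft_q tau_val)

sublocale new: suspension p q tau
proof
  show "2 \<le> CARD('a)" "enumeration p" by (rule old.two old.ord_p)+
  show "enumeration q" by (rule move_enumeration[OF move])
  fix \<alpha>
  show "0 < rgt p tau \<alpha>" if "p \<alpha> < CARD('a)"
    using that w old.above[of \<alpha>] by (auto simp: rgt_p)
  have w0: "rgt q' tau' w < 0"
    using old.below move_less[OF move wl] by auto
  moreover have "rgt q' tau' w - tau' l < 0"
    using old.roof_pos[of w] total old.lft_q(2)[of l]
    unfolding old.roof_rgt by (simp add: rgt_def)
  ultimately show "rgt q tau \<alpha> < 0"
    using old.below[of \<alpha>] move_less[OF move, of \<alpha>] by (auto simp: rgt_q)
qed

text \<open>
  The rectangle \<open>l\<close> is a stack of the former rectangle \<open>l\<close> and a piece of the former rectangle \<open>w\<close>,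
  in a step of top type with the piece of \<open>w\<close> above.
\<close>

lemma roof: "new.roof \<alpha> = (if \<alpha> = l then old.roof l + old.roof w else old.roof \<alpha>)"
  using total by (auto simp: new.roof_def old.roof_def lft_p lft_q rgt_def)

definition pull_back :: "'a \<times> real \<Rightarrow> 'a \<times> real" where
  "pull_back s = (if fst s = l \<and> old.roof l \<le> snd s then (w, snd s - old.roof l) else s)"

text \<open>
  A hop from \<open>w\<close> always leads to the upper part of \<open>l\<close>, which is the right part of the former
  rectangle \<open>w\<close>: nothing happens for the former data. Any other hop is a hop for the former data,
  although possibly by another rule. The upper part of \<open>l\<close> is entered from \<open>w\<close> only, hence all
  other hops arrive at a state that keeps its letter.
\<close>

lemma pull_back_hop:
  assumes "new.hop s s'" "0 \<le> snd s" "snd s < new.roof (fst s)"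
  shows "fst s = w \<and> pull_back s' = pull_back s
    \<or> fst s \<noteq> w \<and> old.hop (pull_back s) (pull_back s') \<and> fst (pull_back s') = fst s'"
  using assms
proof (cases rule: new.hop.cases)
  case (under \<beta> \<alpha> y)
  have "\<alpha> \<noteq> w" using under w new.ord_p enumeration_bounds(2)[OF new.ord_p, of \<beta>] by auto
  moreover have y: "y < rgt p tau' \<alpha>" using under \<open>\<alpha> \<noteq> w\<close> by (simp add: rgt_p)
  moreover have "\<not> (\<beta> = l \<and> old.roof l \<le> y)"
    using y lft_succ[OF old.ord_p under(3), of tau'] old.lft_q(2)[of \<beta>] unfolding old.roof_def by auto
  moreover have "old.hop (w, y - old.roof l) (\<beta>, y)" if "\<alpha> = l"
    using old.hop.under_wrap[OF w l, of \<beta> "y - old.roof l"] under y that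
      old.roof_last_q[OF l w] by simp
  ultimately show ?thesis
    using under old.hop.under[OF under(3) y] by (auto simp: pull_back_def)
next
  case (over \<beta> \<alpha> y)
  show ?thesis
  proof (cases "\<alpha> = w")
    case True
    then have "\<beta> = l" using move_succ[OF move, of \<beta> \<alpha>] over wl by auto
    then show ?thesis using True over wl assms by (auto simp: pull_back_def roof)
  next
    case nw: False
    show ?thesis
    proof (cases "\<alpha> = l")
      case True
      then have b: "\<beta> \<noteq> l" "q' \<beta> = Suc (q' w)" using move_succ[OF move, of \<beta> \<alpha>] over wl by auto
      have y: "rgt p tau' l < y" using over True wl by (simp add: rgt_p)
      have "rgt p tau' w < y - old.roof l"
        using y old.roof_last_q[OF l w] by simp
      then have 1: "old.hop (w, y - old.roof l) (\<beta>, y - old.roof l - old.roof w + old.roof \<beta>)"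
        by (rule old.hop.over[OF b(2)])
      have 2: "old.hop (l, y) (\<beta>, y - old.roof l - old.roof w + old.roof \<beta>)"
        by (rule old.hop.over_wrap[OF l w b(2) y])
      show ?thesis using over True nw b 1 2 by (auto simp: pull_back_def roof algebra_simps)
    next
      case False
      then have b: "\<beta> \<noteq> l" "q' \<beta> = Suc (q' \<alpha>)" using move_succ[OF move, of \<beta> \<alpha>] over nw by auto
      have "rgt p tau' \<alpha> < y" using over nw by (simp add: rgt_p)
      then show ?thesis using over nw False b old.hop.over[OF b(2)] by (auto simp: pull_back_def roof)
    qed
  qed
next
  case (under_wrap \<alpha> \<omega> \<beta> y)
  then have "\<alpha> = w" using w enumeration_eq_iff[OF old.ord_p, of \<alpha> w] by simp
  then show ?thesis using under_wrap assms total_neg by simp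
next
  case (over_wrap \<alpha> \<omega> \<beta> y)
  have om: "\<omega> = w" using over_wrap w enumeration_eq_iff[OF old.ord_p, of \<omega> w] by simp
  have b: "\<beta> = l" using move_succ[OF move, of \<beta> \<omega>] over_wrap om wl by auto
  have e: "\<alpha> \<noteq> w" "Suc (q' (if \<alpha> = l then w else \<alpha>)) = CARD('a)"
    using move_at_end[OF move] over_wrap by auto
  have y: "rgt p tau' \<alpha> < y" using over_wrap e by (simp add: rgt_p)
  show ?thesis
  proof (cases "\<alpha> = l")
    case True
    have "rgt p tau' w < y - old.roof l"
      using y True old.roof_last_q[OF l w] by simp
    then have 1: "old.hop (w, y - old.roof l) (l, y - old.roof l - old.roof w + old.roof l)"
      using e True l by (intro old.hop.over) auto
    have 2: "old.hop (l, y) (l, y - old.roof l - old.roof w + old.roof l)"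
      using e True l y by (intro old.hop.over_wrap[OF l w]) auto
    have 3: "y - old.roof w < old.roof l" using assms over_wrap True by (simp add: roof)
    show ?thesis using over_wrap True e b om wl 1 2 3 by (auto simp: pull_back_def roof algebra_simps)
  next
    case False
    have 1: "old.hop (\<alpha>, y) (l, y - old.roof \<alpha> + old.roof l)"
      using e False l y by (intro old.hop.over) auto
    have "y < old.roof \<alpha>" using assms over_wrap False by (simp add: roof)
    then show ?thesis using over_wrap False e b om wl 1 by (auto simp: pull_back_def roof algebra_simps)
  qed
qed

text \<open>
  The exception for states in \<open>w\<close> is due to the last letter: a visit to \<open>w\<close> saves a letter only when
  the trajectory has moved on to \<open>l\<close>.
\<close>

lemma pull_back_trajectory:
  assumes "new.trajectory as s"
  shows "\<exists>bs. old.trajectory bs (pull_back s) \<and> length bs \<le> length as \<and> (w \<notin> set as \<longrightarrow> bs = as)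
    \<and> (w \<in> set as \<longrightarrow> fst s \<noteq> w \<longrightarrow> length bs < length as)"
  using assms
proof induction
  case (start \<alpha>)
  have "lft p tau \<alpha> < old.roof \<alpha>"
    using start old.lft_q(1)[of l] l old.two
    by (cases "\<alpha> = l") (auto simp: roof lft_p old.roof_def[of l])
  then have "old.trajectory [\<alpha>] (\<alpha>, lft p tau \<alpha>)"
    unfolding lft_p by (rule old.trajectory.start)
  moreover have "pull_back (\<alpha>, lft p tau \<alpha>) = (\<alpha>, lft p tau \<alpha>)"
    using \<open>lft p tau \<alpha> < old.roof \<alpha>\<close> by (auto simp: pull_back_def)
  ultimately show ?case by (intro exI[of _ "[\<alpha>]"]) auto
next
  case (hop as s s')
  then obtain bs where bs: "old.trajectory bs (pull_back s)" "length bs \<le> length as"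
    "w \<notin> set as \<longrightarrow> bs = as" "w \<in> set as \<longrightarrow> fst s \<noteq> w \<longrightarrow> length bs < length as" by blast
  have "fst s \<in> set as" using new.trajectory_fst[OF hop(1)] by (metis list.set_sel(1))
  from pull_back_hop[OF hop(2)] new.trajectory_range[OF hop(1)]
  consider "fst s = w" "pull_back s' = pull_back s"
    | "fst s \<noteq> w" "old.hop (pull_back s) (pull_back s')" "fst (pull_back s') = fst s'" by blast
  then show ?case
  proof cases
    case 1
    then show ?thesis using bs \<open>fst s \<in> set as\<close> by (intro exI[of _ bs]) auto
  next
    case 2
    then show ?thesis using bs old.trajectory.hop[OF bs(1) 2(2)]
      by (intro exI[of _ "fst s' # bs"]) auto
  qed
qed

text \<open>
  A saddle connection cannot end on the right edge of \<open>w\<close>: the singularity there has negative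
  height, since the total of \<open>tau\<close> is negative. So every \<open>w\<close> in the list is followed by \<open>l\<close>.
\<close>

lemma shorten_saddle:
  assumes "new.saddle as"
  shows "\<exists>bs. old.saddle bs \<and> (w \<in> set as \<and> length bs < length as \<or> w \<notin> set as \<and> bs = as)"
proof -
  obtain \<alpha> where a: "new.trajectory as (\<alpha>, rgt p tau \<alpha>)"
    using assms unfolding new.saddle_def by blast
  have aw: "\<alpha> \<noteq> w" using new.trajectory_range[OF a] total_neg by auto
  obtain bs where bs: "old.trajectory bs (pull_back (\<alpha>, rgt p tau \<alpha>))" "w \<notin> set as \<longrightarrow> bs = as"
    "w \<in> set as \<longrightarrow> length bs < length as" using pull_back_trajectory[OF a] aw by auto
  have "pull_back (\<alpha>, rgt p tau \<alpha>) = (\<alpha>, rgt p tau' \<alpha>) \<or> pull_back (\<alpha>, rgt p tau \<alpha>) = (w, rgt p tau' w)"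
    using old.roof_last_q[OF l w] aw by (auto simp: pull_back_def rgt_p)
  then have "old.saddle bs" using bs(1) unfolding old.saddle_def by auto
  then show ?thesis using bs by blast
qed

end

section \<open>Backward steps of bottom type\<close>

text \<open>
  Exchanging top and bottom turns the half-open range of heights around. The steps of bottom type
  are therefore not a mirror image of the above: the piece that moves from \<open>l\<close> to \<open>w\<close> is now the
  lower part of rectangle \<open>l\<close>, and it is cut at height \<open>roof w\<close>.
\<close>

locale bottom_step = old: suspension p' q tau'
  for p' q :: "'a::finite \<Rightarrow> nat" and tau' :: "'a \<Rightarrow> real" +
  fixes p :: "'a \<Rightarrow> nat" and tau :: "'a \<Rightarrow> real" and w l :: 'a
  assumes w: "q w = CARD('a)" and l: "p' l = CARD('a)"
    and p: "p = move_after p' l w" and tau: "tau = tau'(w := tau' w - tau' l)"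
begin

lemma wl: "w \<noteq> l"
  using old.not_both_last w l by auto

lemmas move = old.ord_p l wl p

lemma lft_q: "lft q tau \<alpha> = lft q tau' \<alpha>"
  unfolding tau by (rule lft_upd_last[OF old.ord_q w])

lemma lft_p: "lft p tau \<alpha> = (if \<alpha> = l then rgt p' tau' w - tau' l else lft p' tau' \<alpha>)"
  unfolding tau by (rule lft_move[OF move])

lemma tau_val: "tau \<alpha> = (if \<alpha> = w then tau' w - tau' l else tau' \<alpha>)"
  by (simp add: tau)

lemma total: "rgt q tau w = lft p' tau' l" "rgt q tau' w = rgt p' tau' l"
proof -
  show *: "rgt q tau' w = rgt p' tau' l"
    by (simp add: rgt_last[OF old.ord_q w] rgt_last[OF old.ord_p l])
  show "rgt q tau w = lft p' tau' l"
    using * by (simp add: rgt_def lft_q tau_val)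
qed

lemma total_pos: "0 < rgt q tau w"
  using old.lft_p(1)[of l] l old.two by (simp add: total)

lemma rgt_q: "rgt q tau \<alpha> = (if \<alpha> = w then lft p' tau' l else rgt q tau' \<alpha>)"
  using total by (simp add: rgt_def lft_q tau_val)

lemma rgt_p: "rgt p tau \<alpha> = (if \<alpha> = l then rgt p' tau' w else if \<alpha> = w then rgt p' tau' w - tau' l
   else rgt p' tau' \<alpha>)"
  using wl by (simp add: rgt_def lft_p tau_val)

sublocale new: suspension p q tau
proof
  show "2 \<le> CARD('a)" "enumeration q" by (rule old.two old.ord_q)+
  show "enumeration p" by (rule move_enumeration[OF move])
  fix \<alpha>
  show "rgt q tau \<alpha> < 0" if "q \<alpha> < CARD('a)"
    using that w old.below[of \<alpha>] by (auto simp: rgt_q)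
  have w0: "0 < rgt p' tau' w"
    using old.above move_less[OF move wl] by auto
  moreover have "0 < rgt p' tau' w - tau' l"
    using old.roof_pos[of w] total old.lft_p(2)[of l]
    unfolding old.roof_rgt by (simp add: rgt_def)
  ultimately show "0 < rgt p tau \<alpha>"
    using old.above[of \<alpha>] move_less[OF move, of \<alpha>] by (auto simp: rgt_p)
qed

lemma roof: "new.roof \<alpha> = (if \<alpha> = l then old.roof l + old.roof w else old.roof \<alpha>)"
  using total by (auto simp: new.roof_def old.roof_def lft_p lft_q rgt_def)

definition pull_back :: "'a \<times> real \<Rightarrow> 'a \<times> real" where
  "pull_back s = (if fst s = l then if snd s < old.roof w then (w, snd s) else (l, snd s - old.roof w)
     else s)"

lemma roof_w: "rgt p' tau' w = old.roof w + rgt p' tau' l"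
  by (rule old.roof_last_q[OF w l])

lemma height_w: "rgt p tau w = old.roof w + lft p' tau' l"
  using roof_w wl unfolding rgt_p by (simp add: rgt_def[of p'])

lemma pull_back_hop:
  assumes "new.hop s s'" "0 \<le> snd s" "snd s < new.roof (fst s)"
  shows "fst s = w \<and> pull_back s' = pull_back s
    \<or> fst s \<noteq> w \<and> old.hop (pull_back s) (pull_back s') \<and> fst (pull_back s') = fst s'"
  using assms
proof (cases rule: new.hop.cases)
  case (under \<beta> \<alpha> y)
  show ?thesis
  proof (cases "\<alpha> = w")
    case True
    then have "\<beta> = l" using move_succ[OF move, of \<beta> \<alpha>] under wl by auto
    then show ?thesis using True under wl assms by (auto simp: pull_back_def roof)
  next
    case nw: False
    show ?thesis
    proof (cases "\<alpha> = l")
      case True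
      then have b: "\<beta> \<noteq> l" "p' \<beta> = Suc (p' w)" using move_succ[OF move, of \<beta> \<alpha>] under wl by auto
      have y: "y < rgt p' tau' w" using under True wl by (simp add: rgt_p)
      have 1: "old.hop (w, y) (\<beta>, y)"
        by (rule old.hop.under[OF b(2) y])
      have "y - old.roof w < rgt p' tau' l" using y roof_w by simp
      from old.hop.under_wrap[OF l w b(2) this]
      have 2: "old.hop (l, y - old.roof w) (\<beta>, y)" by simp
      show ?thesis using under True nw b 1 2 by (auto simp: pull_back_def)
    next
      case False
      then have b: "\<beta> \<noteq> l" "p' \<beta> = Suc (p' \<alpha>)" using move_succ[OF move, of \<beta> \<alpha>] under nw by auto
      have "y < rgt p' tau' \<alpha>" using under nw False by (simp add: rgt_p)
      then show ?thesis using under nw False b old.hop.under[OF b(2)] by (auto simp: pull_back_def)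
    qed
  qed
next
  case (over \<beta> \<alpha> y)
  have nw: "\<alpha> \<noteq> w" using over w new.ord_q enumeration_bounds(2)[OF new.ord_q, of \<beta>] by auto
  have "\<alpha> \<noteq> \<beta>" using over(3) by auto
  then have pos: "old.roof w \<le> y - old.roof \<alpha> + new.roof l" if "\<beta> = l"
    using over(4) nw lft_succ[OF old.ord_q over(3), of tau'] old.lft_p(2)[of l] that
    unfolding roof new.roof_rgt[of \<alpha>] old.roof_def
    by (auto simp: rgt_p rgt_q old.roof_rgt[of \<alpha>, unfolded old.roof_def] split: if_splits)
  show ?thesis
  proof (cases "\<alpha> = l")
    case True
    have bl: "\<beta> \<noteq> l" using over True by auto
    have y: "rgt p' tau' w < y" using over True by (simp add: rgt_p)
    have 1: "old.hop (w, y) (\<beta>, y - old.roof w - old.roof l + old.roof \<beta>)"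
      using over True by (intro old.hop.over_wrap[OF w l _ y]) auto
    have "rgt p' tau' l < y - old.roof w" using y roof_w by simp
    then have 2: "old.hop (l, y - old.roof w) (\<beta>, y - old.roof w - old.roof l + old.roof \<beta>)"
      using over True by (intro old.hop.over) auto
    show ?thesis using over True nw bl 1 2 by (auto simp: pull_back_def roof algebra_simps)
  next
    case False
    have "rgt p' tau' \<alpha> < y" using over False nw by (simp add: rgt_p)
    from old.hop.over[OF over(3) this]
    have "old.hop (\<alpha>, y) (\<beta>, y - old.roof \<alpha> + old.roof \<beta>)" .
    then show ?thesis using over False nw pos by (auto simp: pull_back_def roof algebra_simps)
  qed
next
  case (under_wrap \<alpha> \<omega> \<beta> y)
  have om: "\<omega> = w" using under_wrap w enumeration_eq_iff[OF old.ord_q, of \<omega> w] by simp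
  have b: "\<beta> = l" using move_succ[OF move, of \<beta> \<omega>] under_wrap om wl by auto
  have e: "\<alpha> \<noteq> w" "Suc (p' (if \<alpha> = l then w else \<alpha>)) = CARD('a)"
    using move_at_end[OF move] under_wrap by auto
  have r: "new.roof w = old.roof w" using wl by (simp add: roof)
  show ?thesis
  proof (cases "\<alpha> = l")
    case True
    have y: "y < rgt p' tau' w" using under_wrap True by (simp add: rgt_p)
    have 1: "old.hop (w, y) (l, y)"
      using e True l y by (intro old.hop.under) auto
    have "y - old.roof w < rgt p' tau' l" using y roof_w by simp
    from old.hop.under_wrap[OF l w _ this, of l]
    have 2: "old.hop (l, y - old.roof w) (l, y)" using e True l by simp
    show ?thesis using under_wrap True e b om wl r 1 2 assms by (auto simp: pull_back_def)
  next
    case False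
    have "y < rgt p' tau' \<alpha>" using under_wrap e False by (simp add: rgt_p)
    then have 1: "old.hop (\<alpha>, y) (l, y)"
      using e False l by (intro old.hop.under) auto
    then show ?thesis using under_wrap False e b om wl r assms by (auto simp: pull_back_def)
  qed
next
  case (over_wrap \<alpha> \<omega> \<beta> y)
  then have "\<alpha> = w" using w enumeration_eq_iff[OF old.ord_q, of \<alpha> w] by simp
  then have  "y < new.roof w" "rgt p tau w < y" using over_wrap assms by auto
  then show ?thesis using total_pos new.roof_rgt[of w] by simp
qed

lemma pull_back_trajectory:
  assumes "new.trajectory as s"
  shows "\<exists>bs. old.trajectory bs (pull_back s) \<and> length bs \<le> length as \<and> (w \<notin> set as \<longrightarrow> bs = as)
    \<and> (w \<in> set as \<longrightarrow> fst s \<noteq> w \<longrightarrow> length bs < length as)"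
  using assms
proof induction
  case (start \<alpha>)
  have l0: "lft p tau l = old.roof w + lft p' tau' l"
    using height_w wl by (simp add: lft_p rgt_p)
  have "pull_back (\<alpha>, lft p tau \<alpha>) = (\<alpha>, lft p' tau' \<alpha>)" 
    using l0 old.lft_p(2)[of l] by (cases "\<alpha> = l") (auto simp: pull_back_def lft_p)
  moreover have "old.trajectory [\<alpha>] (\<alpha>, lft p' tau' \<alpha>)"
    using start l0 by (intro old.trajectory.start, cases "\<alpha> = l") (auto simp: roof lft_p)
  ultimately show ?case by (intro exI[of _ "[\<alpha>]"]) auto
next
  case (hop as s s')
  then obtain bs where bs: "old.trajectory bs (pull_back s)" "length bs \<le> length as"
    "w \<notin> set as \<longrightarrow> bs = as" "w \<in> set as \<longrightarrow> fst s \<noteq> w \<longrightarrow> length bs < length as" by blast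
  have "fst s \<in> set as" using new.trajectory_fst[OF hop(1)] by (metis list.set_sel(1))
  from pull_back_hop[OF hop(2)] new.trajectory_range[OF hop(1)]
  consider "fst s = w" "pull_back s' = pull_back s"
    | "fst s \<noteq> w" "old.hop (pull_back s) (pull_back s')" "fst (pull_back s') = fst s'" by blast
  then show ?case
  proof cases
    case 1
    then show ?thesis using bs \<open>fst s \<in> set as\<close> by (intro exI[of _ bs]) auto
  next
    case 2
    then show ?thesis using bs old.trajectory.hop[OF bs(1) 2(2)]
      by (intro exI[of _ "fst s' # bs"]) auto
  qed
qed

text \<open>
  Here the singularity on the right edge of \<open>w\<close> lies above the roof, since the total of \<open>tau\<close> is
  positive. So again a saddle connection cannot end in \<open>w\<close>.
\<close>

lemma shorten_saddle:
  assumes "new.saddle as"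
  shows "\<exists>bs. old.saddle bs \<and> (w \<in> set as \<and> length bs < length as \<or> w \<notin> set as \<and> bs = as)"
proof -
  obtain \<alpha> where a: "new.trajectory as (\<alpha>, rgt p tau \<alpha>)"
    using assms unfolding new.saddle_def by blast
  have aw: "\<alpha> \<noteq> w" using new.trajectory_range[OF a] total_pos new.roof_rgt[of w] by auto
  obtain bs where bs: "old.trajectory bs (pull_back (\<alpha>, rgt p tau \<alpha>))" "w \<notin> set as \<longrightarrow> bs = as"
    "w \<in> set as \<longrightarrow> length bs < length as" using pull_back_trajectory[OF a] aw by auto
  have "pull_back (\<alpha>, rgt p tau \<alpha>) = (\<alpha>, rgt p' tau' \<alpha>) \<or> pull_back (\<alpha>, rgt p tau \<alpha>) = (l, rgt p' tau' l)
    \<or> pull_back (\<alpha>, rgt p tau \<alpha>) = (w, rgt p' tau' w)"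
    using roof_w aw by (auto simp: pull_back_def rgt_p)
  then have "old.saddle bs" using bs(1) unfolding old.saddle_def by auto
  then show ?thesis using bs by blast
qed

end

section \<open>Backward Rauzy-Veech induction\<close>

lemma rauzy_top:
  assumes "top_step p q' tau' q tau w l" "lam' l < lam' w" "lam = lam'(w := lam' w - lam' l)"
  shows "rauzy ((p, q'), lam', tau') = Some ((p, q), lam, tau)"
proof -
  interpret top_step p q' tau' q tau w l by fact
  have "w = last_letter p" "l = last_letter q'"
    using w l enumeration_last_iff[OF old.ord_p] enumeration_last_iff[OF old.ord_q] by auto
  then show ?thesis using assms(2,3) q tau by (simp add: rauzy_def Let_def)
qed

lemma rauzy_bottom:
  assumes "bottom_step p' q tau' p tau w l" "lam' l < lam' w" "lam = lam'(w := lam' w - lam' l)"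
  shows "rauzy ((p', q), lam', tau') = Some ((p, q), lam, tau)"
proof -
  interpret bottom_step p' q tau' p tau w l by fact
  have "w = last_letter q" "l = last_letter p'"
    using w l enumeration_last_iff[OF old.ord_p] enumeration_last_iff[OF old.ord_q] by auto
  then show ?thesis using assms(2,3) p tau by (simp add: rauzy_def Let_def)
qed

lemma rauzy_cases:
  fixes E :: "'a::finite triple"
  assumes "2 \<le> CARD('a)" "E \<in> admissible" "rauzy E = Some ((p, q), lam, tau)"
  obtains (top) q' lam' tau' w l where "E = ((p, q'), lam', tau')" "top_step p q' tau' q tau w l"
      "lam' l < lam' w" "lam = lam'(w := lam' w - lam' l)"
  | (bottom) p' lam' tau' w l where "E = ((p', q), lam', tau')" "bottom_step p' q tau' p tau w l"
      "lam' l < lam' w" "lam = lam'(w := lam' w - lam' l)"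
proof -
  obtain p' q' lam' tau' where E: "E = ((p', q'), lam', tau')" by (metis surj_pair)
  have s: "suspension p' q' tau'" using assms(1,2) unfolding E by (simp add: admissible_iff)
  then interpret suspension p' q' tau' .
  let ?t = "last_letter p'" and ?b = "last_letter q'"
  have last: "p' ?t = CARD('a)" "q' ?b = CARD('a)"
    using enumeration_last_iff[OF ord_p] enumeration_last_iff[OF ord_q] by auto
  consider "lam' ?b < lam' ?t" | "lam' ?t < lam' ?b"
    using assms(3) unfolding E rauzy_def by (auto simp: Let_def split: if_splits)
  then show ?thesis
  proof cases
    case 1
    then have r: "p = p'" "q = move_after q' ?b ?t" "lam = lam'(?t := lam' ?t - lam' ?b)"
      "tau = tau'(?t := tau' ?t - tau' ?b)"
      using assms(3) unfolding E rauzy_def by (auto simp: Let_def)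
    show ?thesis
      by (rule top[of q' lam' tau' ?t ?b])
        (use E r 1 s last in \<open>auto simp: top_step_def top_step_axioms_def\<close>)
  next
    case 2
    then have r: "q = q'" "p = move_after p' ?t ?b" "lam = lam'(?b := lam' ?b - lam' ?t)"
      "tau = tau'(?b := tau' ?b - tau' ?t)"
      using assms(3) unfolding E rauzy_def by (auto simp: Let_def)
    show ?thesis
      by (rule bottom[of p' lam' tau' ?b ?t])
        (use E r 2 s last in \<open>auto simp: bottom_step_def bottom_step_axioms_def\<close>)
  qed
qed

lemma (in top_step) total_sum: "sum tau UNIV < 0"
  using total_neg rgt_last[OF new.ord_p w] by simp

lemma (in bottom_step) total_sum: "0 < sum tau UNIV"
  using total_pos rgt_last[OF new.ord_q w] by simp

text \<open>
  The data before the step are determined by those after it, because the loser is the letter next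
  to the winner.
\<close>

lemma (in top_step) old_eq:
  "q l = Suc (q w)" "q' = move_to_end q l" "tau' = tau(w := tau w + tau l)"
  using move_w[OF move] move_to_end_move_after[OF old.ord_q l wl] wl unfolding q[symmetric]
  by (auto simp: tau)

lemma (in bottom_step) old_eq:
  "p l = Suc (p w)" "p' = move_to_end p l" "tau' = tau(w := tau w + tau l)"
  using move_w[OF move] move_to_end_move_after[OF old.ord_p l wl] wl unfolding p[symmetric]
  by (auto simp: tau)

text \<open>
  The sign of the total of \<open>tau\<close> tells the type of the step that led to \<open>D\<close>.
\<close>

lemma rauzy_inj:
  fixes E F :: "'a::finite triple"
  assumes two: "2 \<le> CARD('a)"
    and E: "E \<in> admissible" "rauzy E = Some D" and F: "F \<in> admissible" "rauzy F = Some D"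
  shows "E = F"
proof -
  obtain p q lam tau where D: "D = ((p, q), lam, tau)" by (metis surj_pair)
  note EE = E(2)[unfolded D] and FF = F(2)[unfolded D]
  have upd: "f = (g :: 'a \<Rightarrow> real)(w := g w + g l)" if "g = f(w := f w - f l)" "w \<noteq> l" for f g w l
    using that by auto
  from two E(1) EE show ?thesis
  proof (cases rule: rauzy_cases)
    case (top q1 lam1 tau1 w1 l1)
    then interpret 1: top_step p q1 tau1 q tau w1 l1 by simp
    from two F(1) FF show ?thesis
    proof (cases rule: rauzy_cases)
      case (top q2 lam2 tau2 w2 l2)
      then interpret 2: top_step p q2 tau2 q tau w2 l2 by simp
      have w: "w1 = w2" using "1.w" "2.w" enumeration_eq_iff[OF "1.new.ord_p"] by metis
      then have l: "l1 = l2"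
        using "1.old_eq"(1) "2.old_eq"(1) enumeration_eq_iff[OF "1.new.ord_q"] by metis
      show ?thesis
        using upd[OF top(4) "2.wl"] upd[OF \<open>lam = lam1(w1 := lam1 w1 - lam1 l1)\<close> "1.wl"]
          "1.old_eq" "2.old_eq" w l top(1) \<open>E = _\<close> by metis
    next
      case (bottom p2 lam2 tau2 w2 l2)
      then interpret 2: bottom_step p2 q tau2 p tau w2 l2 by simp
      show ?thesis using "1.total_sum" "2.total_sum" by simp
    qed
  next
    case (bottom p1 lam1 tau1 w1 l1)
    then interpret 1: bottom_step p1 q tau1 p tau w1 l1 by simp
    from two F(1) FF show ?thesis
    proof (cases rule: rauzy_cases)
      case (top q2 lam2 tau2 w2 l2)
      then interpret 2: top_step p q2 tau2 q tau w2 l2 by simp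
      show ?thesis using "1.total_sum" "2.total_sum" by simp
    next
      case (bottom p2 lam2 tau2 w2 l2)
      then interpret 2: bottom_step p2 q tau2 p tau w2 l2 by simp
      have w: "w1 = w2" using "1.w" "2.w" enumeration_eq_iff[OF "1.new.ord_q"] by metis
      then have l: "l1 = l2"
        using "1.old_eq"(1) "2.old_eq"(1) enumeration_eq_iff[OF "1.new.ord_p"] by metis
      show ?thesis
        using upd[OF bottom(4) "2.wl"] upd[OF \<open>lam = lam1(w1 := lam1 w1 - lam1 l1)\<close> "1.wl"]
          "1.old_eq" "2.old_eq" w l bottom(1) \<open>E = _\<close> by metis
    qed
  qed
qed

lemma rauzy_admissible:
  fixes E :: "'a::finite triple"
  assumes two: "2 \<le> CARD('a)" and "E \<in> admissible" "rauzy E = Some D"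
  shows "D \<in> admissible" "rauzy_inv D = Some E"
proof -
  obtain p q lam tau where D: "D = ((p, q), lam, tau)" by (metis surj_pair)
  have "D \<in> admissible \<and> sum tau UNIV \<noteq> 0"
    using two assms(2) assms(3)[unfolded D]
  proof (cases rule: rauzy_cases)
    case (top q' lam' tau' w l)
    then interpret top_step p q' tau' q tau w l by simp
    have "0 < lam' \<alpha>" for \<alpha> using assms(2) unfolding top(1) by (simp add: admissible_iff[OF two])
    then have "0 < lam \<alpha>" for \<alpha> using top(3) unfolding top(4) by simp
    then show ?thesis
      using new.suspension_axioms total_sum unfolding D by (simp add: admissible_iff[OF two])
  next
    case (bottom p' lam' tau' w l)
    then interpret bottom_step p' q tau' p tau w l by simp
    have "0 < lam' \<alpha>" for \<alpha> using assms(2) unfolding bottom(1) by (simp add: admissible_iff[OF two])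
    then have "0 < lam \<alpha>" for \<alpha> using bottom(3) unfolding bottom(4) by simp
    then show ?thesis
      using new.suspension_axioms total_sum unfolding D by (simp add: admissible_iff[OF two])
  qed
  then show "D \<in> admissible" by simp
  have "(THE E. E \<in> admissible \<and> rauzy E = Some D) = E"
    using assms(2,3) rauzy_inj[OF two _ _ assms(2,3)] by (intro the_equality) blast+
  then show "rauzy_inv D = Some E"
    using \<open>D \<in> admissible \<and> sum tau UNIV \<noteq> 0\<close> unfolding D rauzy_inv_def by simp
qed

text \<open>
  For the partial sums of the recovered \<open>tau\<close> in the bottom order one needs all partial sums of the
  present one to be negative, the total included. This is where the sign of the total enters.
\<close>

lemma (in suspension) top_step_ex:
  assumes "sum tau UNIV < 0"
  obtains q' tau' w l where "top_step p q' tau' q tau w l"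
proof -
  have "1 \<le> CARD('a)" using two by simp
  then obtain w where w: "p w = CARD('a)" using enumeration_ex[OF ord_p] by blast
  then have "q w < CARD('a)"
    using not_both_last[of w] enumeration_bounds(2)[OF ord_q, of w] by simp
  then obtain l where l: "q l = Suc (q w)" using enumeration_succ[OF ord_q] by blast
  define q' where "q' = move_to_end q l"
  define tau' where "tau' = tau(w := tau w + tau l)"
  note inv = move_to_end_inverse[OF ord_q l, folded q'_def]
  have tau: "tau = tau'(w := tau' w - tau' l)" using inv(3) by (auto simp: tau'_def)
  have lft: "lft q tau \<alpha> = (if \<alpha> = l then rgt q' tau' w - tau' l else lft q' tau' \<alpha>)" for \<alpha>
    by (subst tau, rule lft_move) (use inv in auto)
  have neg: "rgt q tau \<alpha> < 0" for \<alpha>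
    using below[of \<alpha>] rgt_last[OF ord_q, of \<alpha> tau] assms enumeration_bounds(2)[OF ord_q, of \<alpha>]
    by (cases "q \<alpha> = CARD('a)") auto
  have "suspension p q' tau'"
  proof
    fix \<alpha>
    show "0 < rgt p tau' \<alpha>" if "p \<alpha> < CARD('a)"
      using that w above[of \<alpha>] by (auto simp: rgt_def tau'_def lft_upd_last[OF ord_p w])
    show "rgt q' tau' \<alpha> < 0" if "q' \<alpha> < CARD('a)"
    proof -
      have "\<alpha> \<noteq> l" using that inv(2) by auto
      then show ?thesis
        using neg[of \<alpha>] neg[of l] lft[of \<alpha>] lft[of l] inv(3)
        by (cases "\<alpha> = w") (auto simp: rgt_def tau'_def)
    qed
  qed (rule two ord_p inv)+
  then have "top_step p q' tau' q tau w l"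
    using w inv tau by (simp add: top_step_def top_step_axioms_def)
  then show ?thesis by (rule that)
qed

lemma (in suspension) bottom_step_ex:
  assumes "0 < sum tau UNIV"
  obtains p' tau' w l where "bottom_step p' q tau' p tau w l"
proof -
  have "1 \<le> CARD('a)" using two by simp
  then obtain w where w: "q w = CARD('a)" using enumeration_ex[OF ord_q] by blast
  then have "p w < CARD('a)"
    using not_both_last[of w] enumeration_bounds(2)[OF ord_p, of w] by simp
  then obtain l where l: "p l = Suc (p w)" using enumeration_succ[OF ord_p] by blast
  define p' where "p' = move_to_end p l"
  define tau' where "tau' = tau(w := tau w + tau l)"
  note inv = move_to_end_inverse[OF ord_p l, folded p'_def]
  have tau: "tau = tau'(w := tau' w - tau' l)" using inv(3) by (auto simp: tau'_def)
  have lft: "lft p tau \<alpha> = (if \<alpha> = l then rgt p' tau' w - tau' l else lft p' tau' \<alpha>)" for \<alpha>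
    by (subst tau, rule lft_move) (use inv in auto)
  have pos: "0 < rgt p tau \<alpha>" for \<alpha>
    using above[of \<alpha>] rgt_last[OF ord_p, of \<alpha> tau] assms enumeration_bounds(2)[OF ord_p, of \<alpha>]
    by (cases "p \<alpha> = CARD('a)") auto
  have "suspension p' q tau'"
  proof
    fix \<alpha>
    show "rgt q tau' \<alpha> < 0" if "q \<alpha> < CARD('a)"
      using that w below[of \<alpha>] by (auto simp: rgt_def tau'_def lft_upd_last[OF ord_q w])
    show "0 < rgt p' tau' \<alpha>" if "p' \<alpha> < CARD('a)"
    proof -
      have "\<alpha> \<noteq> l" using that inv(2) by auto
      then show ?thesis
        using pos[of \<alpha>] pos[of l] lft[of \<alpha>] lft[of l] inv(3)
        by (cases "\<alpha> = w") (auto simp: rgt_def tau'_def)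
    qed
  qed (rule two ord_q inv)+
  then have "bottom_step p' q tau' p tau w l"
    using w inv tau by (simp add: bottom_step_def bottom_step_axioms_def)
  then show ?thesis by (rule that)
qed

definition coded_saddle :: "'a::finite triple \<Rightarrow> 'a list \<Rightarrow> bool" where
  "coded_saddle = (\<lambda>((p, q), lam, tau) as. suspension.saddle p q tau as)"

lemma coded_saddle_eq: "coded_saddle ((p, q), lam, tau) as = suspension.saddle p q tau as"
  by (simp add: coded_saddle_def)

text \<open>
  The effect of a backward step with winner \<open>w\<close> on coded saddle connections.
\<close>

definition shortens :: "'a::finite triple \<Rightarrow> 'a \<Rightarrow> 'a triple \<Rightarrow> bool" where
  "shortens D w E \<longleftrightarrow> (\<forall>as. coded_saddle D as \<longrightarrow> (\<exists>bs. coded_saddle E bs \<and>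
    (w \<in> set as \<and> length bs < length as \<or> w \<notin> set as \<and> bs = as)))"

lemma backward_step:
  fixes D :: "'a::finite triple"
  assumes two: "2 \<le> CARD('a)" and D: "D \<in> admissible" and "rauzy_inv D \<noteq> None"
  shows "\<exists>E w. E \<in> admissible \<and> rauzy_inv D = Some E \<and> (\<forall>\<alpha>. is_backward_winner D \<alpha> \<longleftrightarrow> \<alpha> = w)
    \<and> shortens D w E"
proof -
  obtain p q lam tau where Deq: "D = ((p, q), lam, tau)" by (metis surj_pair)
  have s: "suspension p q tau" and pos: "\<And>\<alpha>. 0 < lam \<alpha>"
    using D unfolding Deq by (auto simp: admissible_iff[OF two])
  interpret suspension p q tau by (rule s)
  have "sum tau UNIV \<noteq> 0" using assms(3) by (auto simp: Deq rauzy_inv_def)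
  then consider "sum tau UNIV < 0" | "0 < sum tau UNIV" by linarith
  then show ?thesis
  proof cases
    case 1
    from 1 obtain q' tau' w l where "top_step p q' tau' q tau w l" by (rule top_step_ex)
    then interpret top_step p q' tau' q tau w l .
    define lam' where "lam' = lam(w := lam w + lam l)"
    have lam: "lam = lam'(w := lam' w - lam' l)" "lam' l < lam' w"
      using wl pos[of w] by (auto simp: lam'_def)
    have E: "((p, q'), lam', tau') \<in> admissible"
      using old.suspension_axioms pos by (auto simp: admissible_iff[OF two] lam'_def add_pos_pos)
    have "rauzy ((p, q'), lam', tau') = Some D"
      unfolding Deq by (rule rauzy_top) (use lam top_step_axioms in auto)
    from rauzy_admissible(2)[OF two E this] have "rauzy_inv D = Some ((p, q'), lam', tau')" .
    moreover have "is_backward_winner D \<alpha> \<longleftrightarrow> \<alpha> = w" for \<alpha>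
      using 1 enumeration_last_iff[OF ord_p] w by (auto simp: Deq is_backward_winner_def)
    moreover have "shortens D w ((p, q'), lam', tau')"
      unfolding shortens_def Deq coded_saddle_eq using shorten_saddle by blast
    ultimately show ?thesis using E by blast
  next
    case 2
    from 2 obtain p' tau' w l where "bottom_step p' q tau' p tau w l" by (rule bottom_step_ex)
    then interpret bottom_step p' q tau' p tau w l .
    define lam' where "lam' = lam(w := lam w + lam l)"
    have lam: "lam = lam'(w := lam' w - lam' l)" "lam' l < lam' w"
      using wl pos[of w] by (auto simp: lam'_def)
    have E: "((p', q), lam', tau') \<in> admissible"
      using old.suspension_axioms pos by (auto simp: admissible_iff[OF two] lam'_def add_pos_pos)
    have "rauzy ((p', q), lam', tau') = Some D"
      unfolding Deq by (rule rauzy_bottom) (use lam bottom_step_axioms in auto)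
    from rauzy_admissible(2)[OF two E this] have "rauzy_inv D = Some ((p', q), lam', tau')" .
    moreover have "is_backward_winner D \<alpha> \<longleftrightarrow> \<alpha> = w" for \<alpha>
      using 2 enumeration_last_iff[OF ord_q] w by (auto simp: Deq is_backward_winner_def)
    moreover have "shortens D w ((p', q), lam', tau')"
      unfolding shortens_def Deq coded_saddle_eq using shorten_saddle by blast
    ultimately show ?thesis using E by blast
  qed
qed

section \<open>Descent\<close>

lemma backward_iter_Suc: "backward_iter (Suc n) D = Option.bind (rauzy_inv D) (backward_iter n)"
proof (induction n)
  case 0
  show ?case by (cases "rauzy_inv D") simp_all
next
  case (Suc n)
  have "backward_iter (Suc (Suc n)) D = Option.bind (backward_iter (Suc n) D) rauzy_inv" by simp
  also have "\<dots> = Option.bind (rauzy_inv D) (\<lambda>E. Option.bind (backward_iter n E) rauzy_inv)"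
    unfolding Suc.IH by (cases "rauzy_inv D") auto
  finally show ?case by simp
qed

lemma infinite_Suc_vimage: "infinite {n. P (Suc n)} \<longleftrightarrow> infinite {n. P n}"
proof -
  have "{n. P n} \<subseteq> insert 0 (Suc ` {n. P (Suc n)})"
  proof
    fix n assume "n \<in> {n. P n}"
    then show "n \<in> insert 0 (Suc ` {n. P (Suc n)})" by (cases n) auto
  qed
  moreover have "Suc ` {n. P (Suc n)} \<subseteq> {n. P n}" by auto
  moreover have "finite (Suc ` {n. P (Suc n)}) \<longleftrightarrow> finite {n. P (Suc n)}"
    by (simp add: finite_image_iff)
  ultimately show ?thesis by (metis finite_insert finite_subset)
qed

lemma backward_complete_shift:
  assumes "rauzy_inv D = Some E"
  shows "backward_infinity_complete D \<longleftrightarrow> backward_infinity_complete E"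
proof -
  have S: "backward_iter (Suc n) D = backward_iter n E" for n
    unfolding backward_iter_Suc by (simp add: assms)
  have "(\<forall>n. backward_iter n D \<noteq> None) \<longleftrightarrow> (\<forall>n. backward_iter (Suc n) D \<noteq> None)"
    by (metis backward_iter.simps(1) not0_implies_Suc option.distinct(1))
  then show ?thesis
    unfolding backward_infinity_complete_def
    using infinite_Suc_vimage[of "\<lambda>n. \<exists>F. backward_iter n D = Some F \<and> is_backward_winner F _"]
    by (simp only: S)
qed

lemma complete_defined:
  assumes "backward_infinity_complete D"
  shows "rauzy_inv D \<noteq> None"
proof -
  have "backward_iter (Suc 0) D \<noteq> None"
    using assms unfolding backward_infinity_complete_def by (elim conjE allE)
  then show ?thesis by simp
qed

text \<open>
  Until a letter of the list wins, the list does not change.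
\<close>

lemma complete_shortens_saddle:
  fixes D :: "'a::finite triple"
  assumes two: "2 \<le> CARD('a)"
  shows "D \<in> admissible \<Longrightarrow> backward_infinity_complete D \<Longrightarrow> coded_saddle D as
    \<Longrightarrow> \<alpha> \<in> set as \<Longrightarrow> backward_iter n D = Some F \<Longrightarrow> is_backward_winner F \<alpha>
    \<Longrightarrow> \<exists>(E :: 'a triple) bs. E \<in> admissible \<and> backward_infinity_complete E \<and> coded_saddle E bs
          \<and> length bs < length as"
proof (induction n arbitrary: D)
  case (0 D)
  obtain E w where E: "E \<in> admissible" "rauzy_inv D = Some E"
    and win: "\<forall>\<alpha>. is_backward_winner D \<alpha> \<longleftrightarrow> \<alpha> = w"
    and short: "shortens D w E"
    using backward_step[OF two 0(1) complete_defined[OF 0(2)]] by blast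
  have "\<alpha> = w" using 0(5,6) win by simp
  moreover have "backward_infinity_complete E" using 0(2) backward_complete_shift[OF E(2)] by simp
  moreover obtain bs where "coded_saddle E bs"
    "w \<in> set as \<and> length bs < length as \<or> w \<notin> set as \<and> bs = as"
    using short 0(3) unfolding shortens_def by blast
  ultimately show ?case using 0(4) E(1) by (intro exI[of _ E] exI[of _ bs]) auto
next
  case (Suc n D)
  obtain E w where E: "E \<in> admissible" "rauzy_inv D = Some E"
    and short: "shortens D w E"
    using backward_step[OF two Suc(2) complete_defined[OF Suc(3)]] by blast
  have it: "backward_iter n E = Some F" using Suc(6) unfolding backward_iter_Suc by (simp add: E(2))
  have c: "backward_infinity_complete E" using Suc(3) backward_complete_shift[OF E(2)] by simp
  obtain bs where bs: "coded_saddle E bs"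
    "w \<in> set as \<and> length bs < length as \<or> w \<notin> set as \<and> bs = as"
    using short Suc(4) unfolding shortens_def by blast
  show ?case
  proof (cases "w \<in> set as")
    case True
    then show ?thesis using bs E(1) c by blast
  next
    case False
    then have "coded_saddle E as" using bs by simp
    from Suc.IH[OF E(1) c this Suc(5) it Suc(7)] show ?thesis .
  qed
qed

lemma (in suspension) saddle_nonempty: "saddle as \<Longrightarrow> as \<noteq> []"
  unfolding saddle_def using trajectory_fst by blast

theorem complete_no_saddle:
  fixes D :: "'a::finite triple"
  assumes two: "2 \<le> CARD('a)"
    and "D \<in> admissible" "backward_infinity_complete D" "coded_saddle D as"
  shows False
  using assms(2-)
proof (induction "length as" arbitrary: D as rule: less_induct)
  case less
  obtain p q lam tau where Deq: "D = ((p, q), lam, tau)" by (metis surj_pair)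
  have "suspension p q tau" using less(2) unfolding Deq by (auto simp: admissible_iff[OF two])
  then have "as \<noteq> []"
    using less(4) suspension.saddle_nonempty[of p q tau as] by (simp add: Deq coded_saddle_def)
  then have a: "hd as \<in> set as" by simp
  have "infinite {n. \<exists>E. backward_iter n D = Some E \<and> is_backward_winner E (hd as)}"
    using less(3) unfolding backward_infinity_complete_def by blast
  then obtain n F where "backward_iter n D = Some F" "is_backward_winner F (hd as)"
    using infinite_imp_nonempty by blast
  from complete_shortens_saddle[OF two less(2-4) a this] less(1) show False by blast
qed

text \<open>
  A Rauzy step only prepends one term to the backward orbit.
\<close>

lemma represented_by_transfer:
  fixes D :: "'a::finite triple"
  assumes "represented_by D E" and two: "2 \<le> CARD('a)"
    and "D \<in> admissible" "backward_infinity_complete D"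
  shows "simple_polygon E \<and> E \<in> admissible \<and> backward_infinity_complete E"
  using assms(1,3,4)
proof induction
  case (step D E F)
  then show ?case
    using rauzy_admissible[OF two] backward_complete_shift by blast
qed simp

section \<open>Broken lines as graphs\<close>

text \<open>
  A broken line is the graph of this function. The clamped quotient is the proportion of side \<open>\<alpha>\<close>
  that lies to the left of \<open>x\<close>; written in this way the function is visibly continuous.
\<close>

definition graph_height :: "('a::finite \<Rightarrow> nat) \<Rightarrow> ('a \<Rightarrow> real) \<Rightarrow> ('a \<Rightarrow> real) \<Rightarrow> real \<Rightarrow> real" where
  "graph_height p lam tau x = (\<Sum>\<alpha>\<in>UNIV. tau \<alpha> * max 0 (min 1 ((x - lft p lam \<alpha>) / lam \<alpha>)))"

lemma continuous_on_graph_height: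
  assumes "\<And>\<alpha>. 0 < lam \<alpha>"
  shows "continuous_on A (graph_height p lam tau)"
  unfolding graph_height_def using assms by (intro continuous_intros) (simp add: less_imp_neq[symmetric])

locale weighted_order =
  fixes p :: "'a::finite \<Rightarrow> nat" and lam :: "'a \<Rightarrow> real"
  assumes ord: "enumeration p" and pos: "\<And>\<alpha>. 0 < lam \<alpha>"
begin

lemma lft_nonneg: "0 \<le> lft p lam \<alpha>"
  unfolding lft_def using pos by (intro sum_nonneg) (simp add: less_imp_le)

lemma lft_less_rgt: "lft p lam \<alpha> < rgt p lam \<alpha>"
  using pos by (simp add: rgt_def)

lemma rgt_pos: "0 < rgt p lam \<alpha>"
  using lft_nonneg[of \<alpha>] lft_less_rgt[of \<alpha>] by simp

lemma rgt_le_lft: "p \<alpha> < p \<beta> \<Longrightarrow> rgt p lam \<alpha> \<le> lft p lam \<beta>"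
  unfolding rgt_eq_sum[OF ord] lft_def using pos by (intro sum_mono2) (auto simp: less_imp_le)

lemma rgt_le_total: "rgt p lam \<alpha> \<le> sum lam UNIV"
  unfolding rgt_eq_sum[OF ord] using pos by (intro sum_mono2) (auto simp: less_imp_le)

lemma order_of_overlap: "lft p lam \<alpha> < rgt p lam \<beta> \<Longrightarrow> p \<alpha> \<le> p \<beta>"
  using rgt_le_lft[of \<beta> \<alpha>] by (meson not_le)

lemma letter_unique:
  assumes "lft p lam \<alpha> < x" "x < rgt p lam \<alpha>" "lft p lam \<beta> \<le> x" "x \<le> rgt p lam \<beta>"
  shows "\<alpha> = \<beta>"
proof -
  have "p \<alpha> \<le> p \<beta>" "p \<beta> \<le> p \<alpha>" using assms by (auto intro!: order_of_overlap)
  then show ?thesis using enumeration_eq_iff[OF ord] by simp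
qed

lemma letter_at:
  assumes "0 \<le> x" "x < sum lam UNIV"
  obtains \<alpha> where "lft p lam \<alpha> \<le> x" "x < rgt p lam \<alpha>"
proof -
  have d: "1 \<le> CARD('a)" by (simp add: Suc_leI)
  obtain a where a: "p a = 1" using enumeration_ex[OF ord order_refl d] .
  let ?A = "{\<alpha>. lft p lam \<alpha> \<le> x}"
  have "a \<in> ?A" using a lft_first[OF ord, of a lam] assms by simp
  then have ne: "p ` ?A \<noteq> {}" by blast
  have "Max (p ` ?A) \<in> p ` ?A" by (rule Max_in) (use ne in auto)
  then obtain \<alpha> where al: "lft p lam \<alpha> \<le> x" "p \<alpha> = Max (p ` ?A)" by auto
  have max: "p \<beta> \<le> p \<alpha>" if "lft p lam \<beta> \<le> x" for \<beta>
    unfolding al(2) using that by (intro Max_ge) auto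
  have "x < rgt p lam \<alpha>"
  proof (cases "p \<alpha> = CARD('a)")
    case True
    then show ?thesis using assms rgt_last[OF ord True] by simp
  next
    case False
    then have "p \<alpha> < CARD('a)" using enumeration_bounds(2)[OF ord, of \<alpha>] by simp
    then obtain \<beta> where b: "p \<beta> = Suc (p \<alpha>)" by (rule enumeration_succ[OF ord])
    then show ?thesis using max[of \<beta>] lft_succ[OF ord b, of lam] by (cases "lft p lam \<beta> \<le> x") auto
  qed
  then show ?thesis using that al(1) by blast
qed

lemma graph_height_on:
  assumes "lft p lam \<alpha> \<le> x" "x \<le> rgt p lam \<alpha>"
  shows "graph_height p lam tau x = lft p tau \<alpha> + (x - lft p lam \<alpha>) / lam \<alpha> * tau \<alpha>"
proof -
  have summand: "tau \<beta> * max 0 (min 1 ((x - lft p lam \<beta>) / lam \<beta>)) =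
      (if p \<beta> < p \<alpha> then tau \<beta> else 0) + (if \<beta> = \<alpha> then (x - lft p lam \<alpha>) / lam \<alpha> * tau \<alpha> else 0)" for \<beta>
  proof -
    consider "p \<beta> < p \<alpha>" | "\<beta> = \<alpha>" | "p \<alpha> < p \<beta>"
      using enumeration_eq_iff[OF ord] by (metis linorder_neqE_nat)
    then show ?thesis
    proof cases
      case 1
      then have "rgt p lam \<beta> \<le> x" using rgt_le_lft[OF 1] assms by simp
      then have "1 \<le> (x - lft p lam \<beta>) / lam \<beta>" using pos[of \<beta>] by (simp add: rgt_def)
      then show ?thesis using 1 by auto
    next
      case 2
      have "0 \<le> (x - lft p lam \<alpha>) / lam \<alpha>" "(x - lft p lam \<alpha>) / lam \<alpha> \<le> 1"
        using assms pos[of \<alpha>] by (auto simp: rgt_def)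
      then show ?thesis using 2 by simp
    next
      case 3
      then have "x \<le> lft p lam \<beta>" using rgt_le_lft[OF 3] assms by simp
      then have "(x - lft p lam \<beta>) / lam \<beta> \<le> 0" using pos[of \<beta>] by (simp add: divide_nonpos_pos)
      then show ?thesis using 3 by auto
    qed
  qed
  show ?thesis
    unfolding graph_height_def summand sum.distrib
    by (simp add: sum.If_cases lft_def)
qed

lemma graph_height_lft: "graph_height p lam tau (lft p lam \<alpha>) = lft p tau \<alpha>"
  using graph_height_on[of \<alpha> "lft p lam \<alpha>"] lft_less_rgt[of \<alpha>] by simp

lemma graph_height_rgt: "graph_height p lam tau (rgt p lam \<alpha>) = rgt p tau \<alpha>"
  using graph_height_on[of \<alpha> "rgt p lam \<alpha>"] lft_less_rgt[of \<alpha>] pos[of \<alpha>] by (simp add: rgt_def)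

lemma vertex_rgt: "vertex p lam tau (p \<alpha>) = Complex (rgt p lam \<alpha>) (rgt p tau \<alpha>)"
  by (simp add: vertex_def rgt_eq_sum[OF ord] complex_eq_iff)

lemma vertex_lft: "vertex p lam tau (p \<alpha> - 1) = Complex (lft p lam \<alpha>) (lft p tau \<alpha>)"
proof -
  have "{\<beta>. p \<beta> \<le> p \<alpha> - 1} = {\<beta>. p \<beta> < p \<alpha>}" using enumeration_bounds(1)[OF ord, of \<alpha>] by auto
  then show ?thesis by (simp add: vertex_def lft_def complex_eq_iff)
qed

lemma side_iff: "z \<in> side p lam tau \<alpha> \<longleftrightarrow>
    lft p lam \<alpha> \<le> Re z \<and> Re z \<le> rgt p lam \<alpha> \<and> Im z = graph_height p lam tau (Re z)"
proof
  assume "z \<in> side p lam tau \<alpha>"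
  then obtain u where u: "0 \<le> u" "u \<le> 1" "z = (1 - u) *\<^sub>R Complex (lft p lam \<alpha>) (lft p tau \<alpha>)
      + u *\<^sub>R Complex (rgt p lam \<alpha>) (rgt p tau \<alpha>)"
    unfolding side_def vertex_rgt vertex_lft closed_segment_def by blast
  then have z: "Re z = lft p lam \<alpha> + u * lam \<alpha>" "Im z = lft p tau \<alpha> + u * tau \<alpha>"
    by (simp_all add: u(3) rgt_def) (simp_all add: algebra_simps)
  have "0 \<le> u * lam \<alpha>" "u * lam \<alpha> \<le> lam \<alpha>" using u pos[of \<alpha>] by (auto simp: mult_left_le_one_le less_imp_le)
  then have b: "lft p lam \<alpha> \<le> Re z" "Re z \<le> rgt p lam \<alpha>" by (auto simp: z rgt_def)
  show "lft p lam \<alpha> \<le> Re z \<and> Re z \<le> rgt p lam \<alpha> \<and> Im z = graph_height p lam tau (Re z)"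
    using b graph_height_on[OF b, of tau] z pos[of \<alpha>] by simp
next
  assume a: "lft p lam \<alpha> \<le> Re z \<and> Re z \<le> rgt p lam \<alpha> \<and> Im z = graph_height p lam tau (Re z)"
  define u where "u = (Re z - lft p lam \<alpha>) / lam \<alpha>"
  have u: "0 \<le> u" "u \<le> 1" using a pos[of \<alpha>] by (auto simp: u_def rgt_def)
  have "Re z = lft p lam \<alpha> + u * lam \<alpha>" using pos[of \<alpha>] by (simp add: u_def)
  moreover have "Im z = lft p tau \<alpha> + u * tau \<alpha>" using a graph_height_on[of \<alpha> "Re z" tau] by (simp add: u_def)
  ultimately have "z = (1 - u) *\<^sub>R Complex (lft p lam \<alpha>) (lft p tau \<alpha>)
      + u *\<^sub>R Complex (rgt p lam \<alpha>) (rgt p tau \<alpha>)"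
    by (simp add: complex_eq_iff rgt_def algebra_simps)
  then show "z \<in> side p lam tau \<alpha>"
    unfolding side_def vertex_rgt vertex_lft closed_segment_def using u by blast
qed

lemma broken_line_iff: "z \<in> broken_line p lam tau \<longleftrightarrow>
    0 \<le> Re z \<and> Re z \<le> sum lam UNIV \<and> Im z = graph_height p lam tau (Re z)"
proof
  assume "z \<in> broken_line p lam tau"
  then obtain \<alpha> where "z \<in> side p lam tau \<alpha>" unfolding broken_line_def by blast
  then show "0 \<le> Re z \<and> Re z \<le> sum lam UNIV \<and> Im z = graph_height p lam tau (Re z)"
    unfolding side_iff using lft_nonneg[of \<alpha>] rgt_le_total[of \<alpha>] by linarith
next
  assume a: "0 \<le> Re z \<and> Re z \<le> sum lam UNIV \<and> Im z = graph_height p lam tau (Re z)"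
  have "\<exists>\<alpha>. lft p lam \<alpha> \<le> Re z \<and> Re z \<le> rgt p lam \<alpha>"
  proof (cases "Re z < sum lam UNIV")
    case True
    then show ?thesis using a letter_at[of "Re z"] by (metis less_imp_le)
  next
    case False
    have d: "1 \<le> CARD('a)" by (simp add: Suc_leI)
    obtain t where "p t = CARD('a)" using enumeration_ex[OF ord d order_refl] .
    then have "rgt p lam t = Re z" using rgt_last[OF ord, of t lam] a False by simp
    then show ?thesis using lft_less_rgt[of t] by (intro exI[of _ t]) simp
  qed
  then show "z \<in> broken_line p lam tau" unfolding broken_line_def using a side_iff by blast
qed

lemma vertex_image: "vertex p lam tau ` {0..CARD('a)} = insert 0 (range (\<lambda>\<alpha>. Complex (rgt p lam \<alpha>) (rgt p tau \<alpha>)))"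
proof -
  have "{\<alpha>. p \<alpha> \<le> 0} = {}" using enumeration_bounds(1)[OF ord] by (auto simp: Suc_le_eq)
  then have "vertex p lam tau 0 = 0" unfolding vertex_def by (simp only: sum.empty)
  moreover have "{0..CARD('a)} = insert 0 (range p)"
    using ord unfolding enumeration_def bij_betw_def by auto
  moreover have "vertex p lam tau ` range p = range (\<lambda>\<alpha>. Complex (rgt p lam \<alpha>) (rgt p tau \<alpha>))"
    by (simp add: image_image vertex_rgt)
  ultimately show ?thesis by simp
qed

text \<open>
  A point moving from \<open>x\<close> to \<open>x'\<close> passes the right ends of the letters from \<open>\<alpha>\<close> up to the one
  before \<open>\<beta>\<close>. What is known for each of these passages is composed along the way.
\<close>

lemma letter_chain:
  assumes "x < rgt p lam \<alpha>" "lft p lam \<beta> \<le> x'" "p \<alpha> \<le> p \<beta>"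
    and step: "\<And>\<gamma> \<delta>. p \<delta> = Suc (p \<gamma>) \<Longrightarrow> x < rgt p lam \<gamma> \<Longrightarrow> rgt p lam \<gamma> \<le> x' \<Longrightarrow> Q\<^sup>*\<^sup>* (S \<gamma>) (S \<delta>)"
  shows "Q\<^sup>*\<^sup>* (S \<alpha>) (S \<beta>)"
proof -
  have "p \<gamma> = p \<alpha> + n \<Longrightarrow> p \<gamma> \<le> p \<beta> \<Longrightarrow> Q\<^sup>*\<^sup>* (S \<alpha>) (S \<gamma>)" for n \<gamma>
  proof (induction n arbitrary: \<gamma>)
    case 0
    then show ?case using enumeration_eq_iff[OF ord] by simp
  next
    case (Suc n)
    have "p \<gamma> \<noteq> 1" using Suc(2) enumeration_bounds(1)[OF ord, of \<alpha>] by simp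
    then obtain \<delta> where d: "p \<gamma> = Suc (p \<delta>)" by (rule enumeration_pred[OF ord])
    then have "Q\<^sup>*\<^sup>* (S \<alpha>) (S \<delta>)" using Suc by simp
    moreover have "x < rgt p lam \<delta>"
    proof (cases "\<delta> = \<alpha>")
      case False
      then have "p \<alpha> \<noteq> p \<delta>" using enumeration_eq_iff[OF ord, of \<alpha> \<delta>] by simp
      then have "p \<alpha> < p \<delta>" using Suc(2) d by linarith
      then show ?thesis using rgt_le_lft[of \<alpha> \<delta>] lft_less_rgt[of \<delta>] assms(1) by linarith
    qed (use assms in simp)
    moreover have "rgt p lam \<delta> \<le> x'"
      using rgt_le_lft[of \<delta> \<beta>] assms(2) d Suc(3) by simp
    ultimately show ?case using step[OF d] by (meson rtranclp_trans)
  qed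
  from this[of \<beta> "p \<beta> - p \<alpha>"] show ?thesis using assms(3) by simp
qed

end

section \<open>Simple polygons\<close>

locale simple_suspension = suspension p q tau
  for p q :: "'a::finite \<Rightarrow> nat" and tau :: "'a \<Rightarrow> real" +
  fixes lam :: "'a \<Rightarrow> real"
  assumes lam_pos: "\<And>\<alpha>. 0 < lam \<alpha>"
    and simple: "simple_polygon ((p, q), lam, tau)"
begin

abbreviation "D \<equiv> ((p, q), lam, tau)"
abbreviation "width \<equiv> sum lam UNIV"
abbreviation "upper \<equiv> graph_height p lam tau"
abbreviation "lower \<equiv> graph_height q lam tau"

sublocale top: weighted_order p lam
  using ord_p lam_pos by unfold_locales

sublocale bot: weighted_order q lam
  using ord_q lam_pos by unfold_locales

lemma polygon_iff: "z \<in> polygon D \<longleftrightarrow> 0 \<le> Re z \<and> Re z \<le> width \<and> lower (Re z) \<le> Im z \<and> Im z \<le> upper (Re z)"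
proof
  assume "z \<in> polygon D"
  then obtain u v where "u \<in> broken_line p lam tau" "v \<in> broken_line q lam tau"
    "Re u = Re z" "Re v = Re z" "Im v \<le> Im z" "Im z \<le> Im u" unfolding polygon_def by auto
  then show "0 \<le> Re z \<and> Re z \<le> width \<and> lower (Re z) \<le> Im z \<and> Im z \<le> upper (Re z)"
    by (simp add: top.broken_line_iff bot.broken_line_iff)
next
  assume a: "0 \<le> Re z \<and> Re z \<le> width \<and> lower (Re z) \<le> Im z \<and> Im z \<le> upper (Re z)"
  then have "Complex (Re z) (upper (Re z)) \<in> broken_line p lam tau"
    "Complex (Re z) (lower (Re z)) \<in> broken_line q lam tau"
    by (auto simp: top.broken_line_iff bot.broken_line_iff)
  then show "z \<in> polygon D" unfolding polygon_def prod.case mem_Collect_eq using a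
    by (rule_tac bexI[of _ "Complex (Re z) (upper (Re z))"], rule_tac bexI[of _ "Complex (Re z) (lower (Re z))"]) auto
qed

definition vertices :: "complex set" where
  "vertices = insert 0 (range (\<lambda>\<alpha>. Complex (rgt p lam \<alpha>) (rgt p tau \<alpha>))
    \<union> range (\<lambda>\<alpha>. Complex (rgt q lam \<alpha>) (rgt q tau \<alpha>)))"

lemma singularities_eq: "singularities D = surface_point D ` vertices"
  unfolding singularities_def vertices_def
  by (simp add: top.vertex_image bot.vertex_image)

lemma first_last_ex: "\<exists>\<alpha>. p \<alpha> = 1" "\<exists>\<alpha>. p \<alpha> = CARD('a)" "\<exists>\<alpha>. q \<alpha> = 1" "\<exists>\<alpha>. q \<alpha> = CARD('a)"
  using two enumeration_ex[OF ord_p] enumeration_ex[OF ord_q] by (metis One_nat_def Suc_leI order_refl zero_less_card_finite)+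

lemma vertex_end: "vertex p lam tau (CARD('a)) = Complex width (sum tau UNIV)"
proof -
  obtain t where "p t = CARD('a)" using first_last_ex by blast
  then show ?thesis
    using top.vertex_rgt[of tau t] rgt_last[OF ord_p, of t lam] rgt_last[OF ord_p, of t tau] by simp
qed

lemma upper_neq_lower:
  assumes "0 < x" "x < width"
  shows "upper x \<noteq> lower x"
proof
  assume e: "upper x = lower x"
  have "Complex x (upper x) \<in> broken_line p lam tau \<inter> broken_line q lam tau"
    using e assms by (simp add: top.broken_line_iff bot.broken_line_iff)
  then have "Complex x (upper x) \<in> {0, Complex width (sum tau UNIV)}"
    using simple unfolding simple_polygon_def prod.case vertex_end by (rule subst[where P = "\<lambda>A. _ \<in> A", rotated])
  then show False using assms by (auto simp: complex_eq_iff)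
qed

text \<open>
  The broken lines do not meet over the open interval and are in the right order close to its left
  end, so by the intermediate value theorem they are in the right order everywhere.
\<close>

lemma lower_less_upper:
  assumes x: "0 < x" "x < width"
  shows "lower x < upper x"
proof -
  obtain a b where ab: "p a = 1" "q b = 1" using first_last_ex by blast
  \<comment> \<open>close enough to the left end to lie over the first side of both broken lines\<close>
  define x0 where "x0 = min (lam a) (lam b) / 2"
  have x0: "0 < x0" "x0 < lam a" "x0 < lam b"
    using lam_pos[of a] lam_pos[of b] by (auto simp: x0_def min_def)
  have la: "lft p lam a = 0" "lft q lam b = 0" "lft p tau a = 0" "lft q tau b = 0"
    using lft_first[OF ord_p ab(1)] lft_first[OF ord_q ab(2)] by auto
  have "0 < tau a" "tau b < 0"
    using above[of a] below[of b] two ab la by (auto simp: rgt_def)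
  then have "0 < upper x0" "lower x0 < 0"
    using top.graph_height_on[of a x0 tau] bot.graph_height_on[of b x0 tau] x0 la
    by (auto simp: rgt_def mult_pos_neg divide_neg_pos mult_neg_pos)
  then have g0: "0 < upper x0 - lower x0" by simp
  have x0w: "x0 < width" using x0 la top.rgt_le_total[of a] by (simp add: rgt_def)
  let ?g = "\<lambda>x. upper x - lower x"
  have cont: "continuous_on A ?g" for A
    by (intro continuous_on_diff continuous_on_graph_height lam_pos)
  show ?thesis
  proof (rule ccontr)
    assume "\<not> lower x < upper x"
    then have gx: "?g x \<le> 0" by simp
    have "\<exists>y. min x x0 \<le> y \<and> y \<le> max x x0 \<and> ?g y = 0"
    proof (cases "x \<le> x0")
      case True
      then show ?thesis using IVT'[of ?g x 0 x0] gx g0 cont by auto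
    next
      case False
      then show ?thesis using IVT2'[of ?g x 0 x0] gx g0 cont by auto
    qed
    then obtain y where "min x x0 \<le> y" "y \<le> max x x0" "?g y = 0" by blast
    then show False using upper_neq_lower[of y] x x0(1) x0w by auto
  qed
qed

lemma ends: "upper 0 = 0" "lower 0 = 0" "upper width = sum tau UNIV" "lower width = sum tau UNIV"
proof -
  obtain a b t w where l: "p a = 1" "q b = 1" "p t = CARD('a)" "q w = CARD('a)" using first_last_ex by blast
  show "upper 0 = 0" "lower 0 = 0"
    using top.graph_height_lft[of tau a] bot.graph_height_lft[of tau b]
      lft_first[OF ord_p l(1)] lft_first[OF ord_q l(2)] by auto
  show "upper width = sum tau UNIV" "lower width = sum tau UNIV"
    using top.graph_height_rgt[of tau t] bot.graph_height_rgt[of tau w]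
      rgt_last[OF ord_p l(3)] rgt_last[OF ord_q l(4)] by auto
qed

lemma end_vertex: "Complex width (sum tau UNIV) \<in> vertices"
proof -
  obtain t where t: "p t = CARD('a)" using first_last_ex by blast
  then have "Complex width (sum tau UNIV) = Complex (rgt p lam t) (rgt p tau t)"
    using rgt_last[OF ord_p t] by simp
  then show ?thesis unfolding vertices_def by blast
qed

lemma nonvertex_inside:
  assumes "z \<in> polygon D" "z \<notin> vertices"
  shows "0 < Re z" "Re z < width"
proof -
  have z: "0 \<le> Re z" "Re z \<le> width" "lower (Re z) \<le> Im z" "Im z \<le> upper (Re z)"
    using assms(1) by (auto simp: polygon_iff)
  have "Re z \<noteq> 0"
  proof
    assume "Re z = 0"
    then have "z = 0" using z ends by (simp add: complex_eq_iff)
    then show False using assms(2) by (simp add: vertices_def)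
  qed
  moreover have "Re z \<noteq> width"
  proof
    assume "Re z = width"
    then have "z = Complex width (sum tau UNIV)" using z ends by (simp add: complex_eq_iff)
    then show False using assms(2) end_vertex by simp
  qed
  ultimately show "0 < Re z" "Re z < width" using z by auto
qed

lemma rgt_vertex: "Complex (rgt p lam \<alpha>) (rgt p tau \<alpha>) \<in> vertices"
  "Complex (rgt q lam \<alpha>) (rgt q tau \<alpha>) \<in> vertices"
  by (auto simp: vertices_def)

lemma lft_vertex: "Complex (lft p lam \<alpha>) (lft p tau \<alpha>) \<in> vertices"
  "Complex (lft q lam \<alpha>) (lft q tau \<alpha>) \<in> vertices"
proof -
  show "Complex (lft p lam \<alpha>) (lft p tau \<alpha>) \<in> vertices"
  proof (cases "p \<alpha> = 1")
    case True
    then show ?thesis by (simp add: lft_first[OF ord_p True] vertices_def complex_eq_iff)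
  next
    case False
    then obtain \<beta> where "p \<alpha> = Suc (p \<beta>)" by (rule enumeration_pred[OF ord_p])
    then show ?thesis using rgt_vertex(1)[of \<beta>] by (simp add: lft_succ[OF ord_p])
  qed
  show "Complex (lft q lam \<alpha>) (lft q tau \<alpha>) \<in> vertices"
  proof (cases "q \<alpha> = 1")
    case True
    then show ?thesis by (simp add: lft_first[OF ord_q True] vertices_def complex_eq_iff)
  next
    case False
    then obtain \<beta> where "q \<alpha> = Suc (q \<beta>)" by (rule enumeration_pred[OF ord_q])
    then show ?thesis using rgt_vertex(2)[of \<beta>] by (simp add: lft_succ[OF ord_q])
  qed
qed

lemma top_side_iff: "z \<in> side p lam tau \<alpha> \<longleftrightarrow>
    lft p lam \<alpha> \<le> Re z \<and> Re z \<le> rgt p lam \<alpha> \<and>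
    Im z = lft p tau \<alpha> + (Re z - lft p lam \<alpha>) / lam \<alpha> * tau \<alpha>"
  unfolding top.side_iff using top.graph_height_on[of \<alpha> "Re z" tau] by auto

lemma bot_side_iff: "z \<in> side q lam tau \<alpha> \<longleftrightarrow>
    lft q lam \<alpha> \<le> Re z \<and> Re z \<le> rgt q lam \<alpha> \<and>
    Im z = lft q tau \<alpha> + (Re z - lft q lam \<alpha>) / lam \<alpha> * tau \<alpha>"
  unfolding bot.side_iff using bot.graph_height_on[of \<alpha> "Re z" tau] by auto

lemma vertex_on_both:
  assumes "0 \<le> Re z" "Re z \<le> width" "Im z = upper (Re z)" "Im z = lower (Re z)"
  shows "z = 0 \<or> z = Complex width (sum tau UNIV)"
proof -
  have "Re z = 0 \<or> Re z = width" using upper_neq_lower[of "Re z"] assms by force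
  then show ?thesis using ends assms by (auto simp: complex_eq_iff)
qed

lemma vertex_on_top_side:
  assumes "z \<in> side p lam tau \<alpha>"
  shows "z \<in> vertices \<longleftrightarrow> Re z = lft p lam \<alpha> \<or> Re z = rgt p lam \<alpha>"
proof
  assume e: "Re z = lft p lam \<alpha> \<or> Re z = rgt p lam \<alpha>"
  have "Im z = upper (Re z)" using assms by (simp add: top.side_iff)
  then have "z = Complex (lft p lam \<alpha>) (lft p tau \<alpha>) \<or> z = Complex (rgt p lam \<alpha>) (rgt p tau \<alpha>)"
    using e top.graph_height_lft[of tau \<alpha>] top.graph_height_rgt[of tau \<alpha>] by (auto simp: complex_eq_iff)
  then show "z \<in> vertices" using lft_vertex rgt_vertex by auto
next
  assume v: "z \<in> vertices"
  have z: "lft p lam \<alpha> \<le> Re z" "Re z \<le> rgt p lam \<alpha>" "Im z = upper (Re z)"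
    using assms by (auto simp: top.side_iff)
  have zero: "Re z = lft p lam \<alpha>" if "Re z = 0"
    using z top.lft_nonneg[of \<alpha>] that by simp
  have total: "Re z = rgt p lam \<alpha>" if "Re z = width"
    using z top.rgt_le_total[of \<alpha>] that by simp
  consider "z = 0" | \<beta> where "z = Complex (rgt p lam \<beta>) (rgt p tau \<beta>)"
    | \<beta> where "z = Complex (rgt q lam \<beta>) (rgt q tau \<beta>)" using v unfolding vertices_def by auto
  then show "Re z = lft p lam \<alpha> \<or> Re z = rgt p lam \<alpha>"
  proof cases
    case 1
    then show ?thesis using zero by simp
  next
    case (2 \<beta>)
    show ?thesis
    proof (rule ccontr)
      assume "\<not> ?thesis"
      then have "lft p lam \<alpha> < rgt p lam \<beta>" "rgt p lam \<beta> < rgt p lam \<alpha>" using z 2 by auto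
      then have "\<alpha> = \<beta>" using top.letter_unique[of \<alpha> "rgt p lam \<beta>" \<beta>] top.lft_less_rgt[of \<beta>] by simp
      then show False using \<open>rgt p lam \<beta> < rgt p lam \<alpha>\<close> by simp
    qed
  next
    case (3 \<beta>)
    then have "Im z = lower (Re z)" by (simp add: bot.graph_height_rgt)
    then have "z = 0 \<or> z = Complex width (sum tau UNIV)"
      using vertex_on_both[of z] z top.lft_nonneg[of \<alpha>] top.rgt_le_total[of \<alpha>] by linarith
    then show ?thesis using zero total by auto
  qed
qed

lemma vertex_on_bot_side:
  assumes "z \<in> side q lam tau \<alpha>"
  shows "z \<in> vertices \<longleftrightarrow> Re z = lft q lam \<alpha> \<or> Re z = rgt q lam \<alpha>"
proof
  assume e: "Re z = lft q lam \<alpha> \<or> Re z = rgt q lam \<alpha>"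
  have "Im z = lower (Re z)" using assms by (simp add: bot.side_iff)
  then have "z = Complex (lft q lam \<alpha>) (lft q tau \<alpha>) \<or> z = Complex (rgt q lam \<alpha>) (rgt q tau \<alpha>)"
    using e bot.graph_height_lft[of tau \<alpha>] bot.graph_height_rgt[of tau \<alpha>] by (auto simp: complex_eq_iff)
  then show "z \<in> vertices" using lft_vertex rgt_vertex by auto
next
  assume v: "z \<in> vertices"
  have z: "lft q lam \<alpha> \<le> Re z" "Re z \<le> rgt q lam \<alpha>" "Im z = lower (Re z)"
    using assms by (auto simp: bot.side_iff)
  have zero: "Re z = lft q lam \<alpha>" if "Re z = 0"
    using z bot.lft_nonneg[of \<alpha>] that by simp
  have total: "Re z = rgt q lam \<alpha>" if "Re z = width"
    using z bot.rgt_le_total[of \<alpha>] that by simp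
  consider "z = 0" | \<beta> where "z = Complex (rgt p lam \<beta>) (rgt p tau \<beta>)"
    | \<beta> where "z = Complex (rgt q lam \<beta>) (rgt q tau \<beta>)" using v unfolding vertices_def by auto
  then show "Re z = lft q lam \<alpha> \<or> Re z = rgt q lam \<alpha>"
  proof cases
    case 1
    then show ?thesis using zero by simp
  next
    case (3 \<beta>)
    show ?thesis
    proof (rule ccontr)
      assume "\<not> ?thesis"
      then have "lft q lam \<alpha> < rgt q lam \<beta>" "rgt q lam \<beta> < rgt q lam \<alpha>" using z 3 by auto
      then have "\<alpha> = \<beta>" using bot.letter_unique[of \<alpha> "rgt q lam \<beta>" \<beta>] bot.lft_less_rgt[of \<beta>] by simp
      then show False using \<open>rgt q lam \<beta> < rgt q lam \<alpha>\<close> by simp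
    qed
  next
    case (2 \<beta>)
    then have "Im z = upper (Re z)" by (simp add: top.graph_height_rgt)
    then have "z = 0 \<or> z = Complex width (sum tau UNIV)"
      using vertex_on_both[of z] z bot.lft_nonneg[of \<alpha>] bot.rgt_le_total[of \<alpha>] by linarith
    then show ?thesis using zero total by auto
  qed
qed

section \<open>Glued points\<close>

text \<open>
  The gluing of side \<open>\<alpha>\<close>, with \<open>z\<close> on the top side and \<open>z'\<close> on the bottom side.
\<close>

definition crossing :: "'a \<Rightarrow> complex \<Rightarrow> complex \<Rightarrow> bool" where
  "crossing \<alpha> z z' \<longleftrightarrow> z \<in> side p lam tau \<alpha> \<and> z' \<in> side q lam tau \<alpha>
    \<and> Re z' - lft q lam \<alpha> = Re z - lft p lam \<alpha> \<and> Im z' = Im z - roof \<alpha>"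

lemma side_gluing_crossing: "(z, z') \<in> side_gluing D \<longleftrightarrow> (\<exists>\<alpha>. crossing \<alpha> z z')"
proof -
  have "z \<in> side p lam tau \<alpha> \<and> z' = z + (vertex q lam tau (q \<alpha> - 1) - vertex p lam tau (p \<alpha> - 1))
    \<longleftrightarrow> crossing \<alpha> z z'" for \<alpha>
    unfolding crossing_def top.vertex_lft bot.vertex_lft complex_eq_iff
    by (auto simp: top_side_iff bot_side_iff rgt_def roof_def)
  then show ?thesis unfolding side_gluing_def by auto
qed

lemma crossing_vertex: "crossing \<alpha> z z' \<Longrightarrow> z \<in> vertices \<longleftrightarrow> z' \<in> vertices"
  by (auto simp: crossing_def vertex_on_top_side vertex_on_bot_side rgt_def)

lemma nonvertex_sides_disjoint:
  assumes "z \<in> side p lam tau \<alpha>" "z \<in> side q lam tau \<beta>"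
  shows "z \<in> vertices"
proof -
  have "z = 0 \<or> z = Complex width (sum tau UNIV)"
    using assms vertex_on_both[of z] top.lft_nonneg[of \<alpha>] top.rgt_le_total[of \<alpha>]
    unfolding top.side_iff bot.side_iff by linarith
  then show ?thesis using end_vertex by (auto simp: vertices_def)
qed

lemma top_side_interior:
  assumes "z \<in> side p lam tau \<alpha>" "z \<notin> vertices"
  shows "lft p lam \<alpha> < Re z" "Re z < rgt p lam \<alpha>"
  using assms vertex_on_top_side[OF assms(1)] unfolding top_side_iff by linarith+

lemma bot_side_interior:
  assumes "z \<in> side q lam tau \<alpha>" "z \<notin> vertices"
  shows "lft q lam \<alpha> < Re z" "Re z < rgt q lam \<alpha>"
  using assms vertex_on_bot_side[OF assms(1)] unfolding bot_side_iff by linarith+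

lemma crossing_inj:
  assumes "z \<notin> vertices"
  shows "crossing \<alpha> z z1 \<Longrightarrow> crossing \<beta> z z2 \<Longrightarrow> z1 = z2"
    "crossing \<alpha> z1 z \<Longrightarrow> crossing \<beta> z2 z \<Longrightarrow> z1 = z2"
    "crossing \<alpha> z1 z \<Longrightarrow> \<not> crossing \<beta> z z2"
proof -
  { assume c: "crossing \<alpha> z z1" "crossing \<beta> z z2"
    then have s: "z \<in> side p lam tau \<alpha>" "z \<in> side p lam tau \<beta>" by (auto simp: crossing_def)
    have "\<alpha> = \<beta>"
      using s top_side_interior[OF s(1) assms] unfolding top_side_iff by (intro top.letter_unique) auto
    then show "z1 = z2" using c by (auto simp: crossing_def complex_eq_iff) }
  { assume c: "crossing \<alpha> z1 z" "crossing \<beta> z2 z"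
    then have s: "z \<in> side q lam tau \<alpha>" "z \<in> side q lam tau \<beta>" by (auto simp: crossing_def)
    have "\<alpha> = \<beta>"
      using s bot_side_interior[OF s(1) assms] unfolding bot_side_iff by (intro bot.letter_unique) auto
    then show "z1 = z2" using c by (auto simp: crossing_def complex_eq_iff) }
  { assume c: "crossing \<alpha> z1 z"
    show "\<not> crossing \<beta> z z2"
      using c nonvertex_sides_disjoint[of z \<beta> \<alpha>] assms by (auto simp: crossing_def) }
qed

lemma glued_vertex:
  assumes "(z, z') \<in> glued D"
  shows "z \<in> vertices \<longleftrightarrow> z' \<in> vertices"
  using assms unfolding glued_def
proof (induction rule: rtrancl_induct)
  case (step y z)
  then show ?case using crossing_vertex side_gluing_crossing by auto
qed simp

text \<open>
  A point other than a vertex lies on at most one side, and its partner on no other side than the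
  partner side. So a chain of gluings that starts at such a point only goes back and forth.
\<close>

lemma glued_nonvertex:
  assumes "(z, z') \<in> glued D" "z \<notin> vertices"
  shows "z' = z \<or> (\<exists>\<alpha>. crossing \<alpha> z z') \<or> (\<exists>\<alpha>. crossing \<alpha> z' z)"
  using assms(1) unfolding glued_def
proof (induction rule: rtrancl_induct)
  case (step y y')
  have y: "y \<notin> vertices" using step(1) assms(2) glued_vertex[of z y] by (simp add: glued_def)
  consider \<alpha> where "crossing \<alpha> y y'" | \<alpha> where "crossing \<alpha> y' y"
    using step(2) by (auto simp: side_gluing_crossing)
  then show ?case
    using step(3) crossing_inj[OF y] by cases metis+
qed simp

lemma glued_sym: "(z, z') \<in> glued D \<Longrightarrow> (z', z) \<in> glued D"
  unfolding glued_def by (rule symD[OF sym_rtrancl]) (auto simp: sym_def)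

lemma surface_point_singular: "surface_point D z \<in> singularities D \<longleftrightarrow> z \<in> vertices"
proof
  assume "surface_point D z \<in> singularities D"
  then obtain v where v: "v \<in> vertices" "surface_point D z = surface_point D v"
    unfolding singularities_eq by blast
  have "z \<in> surface_point D z" by (simp add: surface_point_def glued_def)
  then have "(v, z) \<in> glued D" unfolding v(2) by (simp add: surface_point_def)
  then show "z \<in> vertices" using glued_vertex v(1) by blast
qed (simp add: singularities_eq)


end

context simple_suspension
begin

section \<open>Points of the polygon and states\<close>

definition last_top :: 'a where "last_top = last_letter p"
definition last_bot :: 'a where "last_bot = last_letter q"

lemma last_top_iff: "p \<alpha> = CARD('a) \<longleftrightarrow> \<alpha> = last_top"
  unfolding last_top_def by (rule enumeration_last_iff[OF ord_p])

lemma last_bot_iff: "q \<alpha> = CARD('a) \<longleftrightarrow> \<alpha> = last_bot"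
  unfolding last_bot_def by (rule enumeration_last_iff[OF ord_q])

lemma last_neq: "last_top \<noteq> last_bot"
  using not_both_last last_top_iff last_bot_iff by metis

lemma rgt_p_pos: "\<alpha> \<noteq> last_top \<Longrightarrow> 0 < rgt p tau \<alpha>"
  using above[of \<alpha>] enumeration_bounds(2)[OF ord_p, of \<alpha>] last_top_iff[of \<alpha>] by linarith

lemma rgt_q_neg: "\<alpha> \<noteq> last_bot \<Longrightarrow> rgt q tau \<alpha> < 0"
  using below[of \<alpha>] enumeration_bounds(2)[OF ord_q, of \<alpha>] last_bot_iff[of \<alpha>] by linarith

lemma rgt_last_top: "rgt p tau last_top = sum tau UNIV" "rgt p lam last_top = width"
  and rgt_last_bot: "rgt q tau last_bot = sum tau UNIV" "rgt q lam last_bot = width"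
  using rgt_last[OF ord_p, of last_top] rgt_last[OF ord_q, of last_bot] last_top_iff last_bot_iff by auto

lemma height_last_bot: "rgt p tau last_bot = roof last_bot + sum tau UNIV"
  by (simp add: roof_rgt rgt_last_bot)

text \<open>
  The states assigned below to points of the polygon may lie above the roof of the last bottom
  letter or below the base of the last top letter. Moving right, such a point next passes
  the right end of the base interval, and it is replaced by the state from which it does so, by
  \<open>under_wrap\<close> or \<open>over_wrap\<close>.
\<close>

definition carry :: "'a \<times> real \<Rightarrow> 'a \<times> real" where
  "carry s = (if fst s = last_bot \<and> roof last_bot \<le> snd s then (last_top, snd s - roof last_bot)
     else if fst s = last_top \<and> snd s < 0 then (last_bot, snd s + roof last_bot) else s)"

lemma carry_id: "0 \<le> y \<Longrightarrow> y < roof \<alpha> \<Longrightarrow> carry (\<alpha>, y) = (\<alpha>, y)"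
  by (auto simp: carry_def)

text \<open>
  If \<open>carry\<close> acts on the first state, the hop is one at the right end of the base interval. It never
  acts on the second one: below the vertex at its left end, a top side lies under the roof.
\<close>

lemma hop_under_carry:
  assumes "p \<delta> = Suc (p \<gamma>)" "0 \<le> y" "y < rgt p tau \<gamma>"
  shows "hop (carry (\<gamma>, y)) (carry (\<delta>, y))"
proof -
  have "y < roof \<delta>"
    using assms lft_succ[OF ord_p assms(1), of tau] lft_q(2)[of \<delta>] by (simp add: roof_def)
  then have 1: "carry (\<delta>, y) = (\<delta>, y)" using assms(2) by (intro carry_id)
  show ?thesis
  proof (cases "\<gamma> = last_bot \<and> roof last_bot \<le> y")
    case True
    have "y - roof last_bot < rgt p tau last_top"
      using True assms(3) by (simp add: height_last_bot rgt_last_top)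
    from hop.under_wrap[OF _ _ _ this, of last_bot \<delta>] True assms(1)
    have "hop (last_top, y - roof last_bot) (\<delta>, y)" using last_top_iff last_bot_iff by auto
    then show ?thesis using True 1 by (simp add: carry_def)
  next
    case False
    then have "carry (\<gamma>, y) = (\<gamma>, y)" using assms(2) by (auto simp: carry_def)
    then show ?thesis using 1 assms by (auto intro: hop.under)
  qed
qed

lemma hop_over_carry:
  assumes "q \<delta> = Suc (q \<gamma>)" "y < 0" "rgt q tau \<gamma> < y"
  shows "hop (carry (\<gamma>, y + roof \<gamma>)) (carry (\<delta>, y + roof \<delta>))"
proof -
  have "0 \<le> y + roof \<delta>"
    using assms lft_succ[OF ord_q assms(1), of tau] lft_p(2)[of \<delta>] by (simp add: roof_def)
  then have 1: "carry (\<delta>, y + roof \<delta>) = (\<delta>, y + roof \<delta>)" using assms(2) by (intro carry_id) auto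
  have y: "rgt p tau \<gamma> < y + roof \<gamma>" using assms(3) by (simp add: roof_rgt)
  show ?thesis
  proof (cases "\<gamma> = last_top \<and> y + roof \<gamma> < 0")
    case True
    have "rgt p tau last_bot < y + roof last_top + roof last_bot"
      using True y by (simp add: height_last_bot rgt_last_top)
    from hop.over_wrap[OF _ _ _ this, of last_top \<delta>] True assms(1)
    have "hop (last_bot, y + roof last_top + roof last_bot) (\<delta>, y + roof \<delta>)"
      using last_top_iff last_bot_iff by auto
    then show ?thesis unfolding 1 using True last_neq by (auto simp: carry_def)
  next
    case False
    then have "carry (\<gamma>, y + roof \<gamma>) = (\<gamma>, y + roof \<gamma>)" using assms(2) by (auto simp: carry_def)
    then show ?thesis using 1 assms y hop.over[OF assms(1) y] by simp
  qed
qed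

definition reached :: "'a \<times> real \<Rightarrow> bool" where
  "reached s \<longleftrightarrow> (\<exists>as. trajectory as s)"

lemma reached_hops: "hop\<^sup>*\<^sup>* s s' \<Longrightarrow> reached s \<Longrightarrow> reached s'"
  by (induction rule: rtranclp_induct) (auto simp: reached_def intro: trajectory.hop)

lemma slide_under:
  assumes "x < rgt p lam \<alpha>" "lft p lam \<beta> \<le> x'" "p \<alpha> \<le> p \<beta>" "0 \<le> y"
    and "\<And>\<gamma>. x < rgt p lam \<gamma> \<Longrightarrow> rgt p lam \<gamma> \<le> x' \<Longrightarrow> y < rgt p tau \<gamma>"
  shows "hop\<^sup>*\<^sup>* (carry (\<alpha>, y)) (carry (\<beta>, y))"
  by (rule top.letter_chain[OF assms(1-3), of hop "\<lambda>\<gamma>. carry (\<gamma>, y)"])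
    (use hop_under_carry assms(4,5) in blast)

lemma slide_over:
  assumes "x < rgt q lam \<alpha>" "lft q lam \<beta> \<le> x'" "q \<alpha> \<le> q \<beta>" "y < 0"
    and "\<And>\<gamma>. x < rgt q lam \<gamma> \<Longrightarrow> rgt q lam \<gamma> \<le> x' \<Longrightarrow> rgt q tau \<gamma> < y"
  shows "hop\<^sup>*\<^sup>* (carry (\<alpha>, y + roof \<alpha>)) (carry (\<beta>, y + roof \<beta>))"
  by (rule bot.letter_chain[OF assms(1-3), of hop "\<lambda>\<gamma>. carry (\<gamma>, y + roof \<gamma>)"])
    (use hop_over_carry assms(4,5) in blast)

text \<open>
  The state of a point of the polygon. Letters are taken with half-open intervals, closed on the
  left, as befits motion to the right.
\<close>

definition located :: "complex \<Rightarrow> 'a \<times> real \<Rightarrow> bool" where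
  "located z s \<longleftrightarrow> (if 0 \<le> Im z
     then lft p lam (fst s) \<le> Re z \<and> Re z < rgt p lam (fst s) \<and> snd s = Im z
     else lft q lam (fst s) \<le> Re z \<and> Re z < rgt q lam (fst s) \<and> snd s = Im z + roof (fst s))"

lemma polygon_below_vertex:
  assumes "z \<in> polygon D" "z \<notin> vertices"
  shows "Re z = rgt p lam \<gamma> \<Longrightarrow> Im z < rgt p tau \<gamma>" "Re z = rgt q lam \<gamma> \<Longrightarrow> rgt q tau \<gamma> < Im z"
proof -
  have z: "lower (Re z) \<le> Im z" "Im z \<le> upper (Re z)" using assms(1) by (auto simp: polygon_iff)
  show "Im z < rgt p tau \<gamma>" if "Re z = rgt p lam \<gamma>"
    using z that assms(2) rgt_vertex(1)[of \<gamma>] top.graph_height_rgt[of tau \<gamma>]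
    by (metis complex_surj order.not_eq_order_implies_strict)
  show "rgt q tau \<gamma> < Im z" if "Re z = rgt q lam \<gamma>"
    using z that assms(2) rgt_vertex(2)[of \<gamma>] bot.graph_height_rgt[of tau \<gamma>]
    by (metis complex_surj order.not_eq_order_implies_strict)
qed

text \<open>
  A horizontal segment in the polygon that does not meet a vertex before \<open>x'\<close> passes strictly below
  the vertices of the top line and strictly above those of the bottom line.
\<close>

lemma segment_crossings:
  assumes "\<And>r. 0 \<le> r \<Longrightarrow> r \<le> s \<Longrightarrow> z + of_real r \<in> polygon D"
    and "\<And>r. 0 < r \<Longrightarrow> r \<le> s \<Longrightarrow> Re z + r \<le> x' \<Longrightarrow> z + of_real r \<notin> vertices"
    and "x' \<le> Re z + s"
  shows "Re z < rgt p lam \<gamma> \<Longrightarrow> rgt p lam \<gamma> \<le> x' \<Longrightarrow> Im z < rgt p tau \<gamma>"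
    "Re z < rgt q lam \<gamma> \<Longrightarrow> rgt q lam \<gamma> \<le> x' \<Longrightarrow> rgt q tau \<gamma> < Im z"
proof -
  show "Im z < rgt p tau \<gamma>" if "Re z < rgt p lam \<gamma>" "rgt p lam \<gamma> \<le> x'"
    using polygon_below_vertex(1)[of "z + of_real (rgt p lam \<gamma> - Re z)" \<gamma>]
      assms(1,2)[of "rgt p lam \<gamma> - Re z"] that assms(3) by simp
  show "rgt q tau \<gamma> < Im z" if "Re z < rgt q lam \<gamma>" "rgt q lam \<gamma> \<le> x'"
    using polygon_below_vertex(2)[of "z + of_real (rgt q lam \<gamma> - Re z)" \<gamma>]
      assms(1,2)[of "rgt q lam \<gamma> - Re z"] that assms(3) by simp
qed

lemma slide_segment:
  assumes "0 < s" "\<And>r. 0 \<le> r \<Longrightarrow> r \<le> s \<Longrightarrow> z + of_real r \<in> polygon D"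
    and nv: "\<And>r. 0 < r \<Longrightarrow> r \<le> s \<Longrightarrow> z + of_real r \<notin> vertices"
    and a: "located z a"
  shows "\<exists>b. located (z + of_real s) b \<and> hop\<^sup>*\<^sup>* (carry a) (carry b)"
proof -
  let ?x = "Re z + s"
  have "z + of_real s \<in> polygon D" "z + of_real s \<notin> vertices" using assms(1-3) by auto
  from nonvertex_inside[OF this] have x: "0 \<le> ?x" "?x < width" by auto
  obtain \<alpha> y where ay: "a = (\<alpha>, y)" by (metis surj_pair)
  note cross = segment_crossings[OF assms(2), of s ?x, OF _ _ nv order_refl]
  show ?thesis
  proof (cases "0 \<le> Im z")
    case True
    then have al: "lft p lam \<alpha> \<le> Re z" "Re z < rgt p lam \<alpha>" "y = Im z"
      using a by (auto simp: located_def ay)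
    obtain \<beta> where b: "lft p lam \<beta> \<le> ?x" "?x < rgt p lam \<beta>" by (rule top.letter_at[OF x])
    have "p \<alpha> \<le> p \<beta>" by (rule top.order_of_overlap) (use al b assms(1) in linarith)
    then have "hop\<^sup>*\<^sup>* (carry (\<alpha>, y)) (carry (\<beta>, y))"
      using slide_under[OF al(2) b(1)] cross(1) True al(3) by auto
    moreover have "located (z + of_real s) (\<beta>, y)" using True b al by (simp add: located_def)
    ultimately show ?thesis unfolding ay by blast
  next
    case False
    then have al: "lft q lam \<alpha> \<le> Re z" "Re z < rgt q lam \<alpha>" "y = Im z + roof \<alpha>"
      using a by (auto simp: located_def ay)
    obtain \<beta> where b: "lft q lam \<beta> \<le> ?x" "?x < rgt q lam \<beta>" by (rule bot.letter_at[OF x])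
    have "q \<alpha> \<le> q \<beta>" by (rule bot.order_of_overlap) (use al b assms(1) in linarith)
    then have "hop\<^sup>*\<^sup>* (carry (\<alpha>, Im z + roof \<alpha>)) (carry (\<beta>, Im z + roof \<beta>))"
      using slide_over[OF al(2) b(1)] cross(2) False al(3) by auto
    moreover have "located (z + of_real s) (\<beta>, Im z + roof \<beta>)" using False b al by (simp add: located_def)
    ultimately show ?thesis unfolding ay al(3) by blast
  qed
qed

section \<open>Passing through a side\<close>

text \<open>
  A flow line that arrives at \<open>z\<close> from the left inside the polygon. Such a line can leave through a
  top side only if that side descends, and through a bottom side only if it rises
  (\<open>entered_slope\<close>).
\<close>

definition entered :: "complex \<Rightarrow> bool" where
  "entered z \<longleftrightarrow> (\<exists>\<epsilon>>0. \<forall>r\<in>{0..\<epsilon>}. z - of_real r \<in> polygon D)"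

lemma entered_slope:
  assumes "entered z" "z \<notin> vertices"
  shows "z \<in> side p lam tau \<alpha> \<Longrightarrow> tau \<alpha> \<le> 0" "z \<in> side q lam tau \<alpha> \<Longrightarrow> 0 \<le> tau \<alpha>"
proof -
  obtain e where e: "0 < e" "\<And>r. 0 \<le> r \<Longrightarrow> r \<le> e \<Longrightarrow> z - of_real r \<in> polygon D"
    using assms(1) unfolding entered_def by auto
  show "tau \<alpha> \<le> 0" if z: "z \<in> side p lam tau \<alpha>"
  proof -
    \<comment> \<open>a step to the left that stays in the polygon and over the same side\<close>
    define r where "r = min e (Re z - lft p lam \<alpha>)"
    have r: "0 < r" "r \<le> e" "r \<le> Re z - lft p lam \<alpha>"
      using top_side_interior[OF z assms(2)] e(1) by (auto simp: r_def)
    have "z - of_real r \<in> polygon D" using e(2)[of r] r by simp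
    then have "Im z \<le> upper (Re z - r)" by (simp add: polygon_iff)
    also have "\<dots> = lft p tau \<alpha> + (Re z - r - lft p lam \<alpha>) / lam \<alpha> * tau \<alpha>"
      using r z by (intro top.graph_height_on) (auto simp: top_side_iff)
    also have "\<dots> = Im z - r / lam \<alpha> * tau \<alpha>"
      using z lam_pos[of \<alpha>] by (simp add: top_side_iff field_simps)
    finally have "r / lam \<alpha> * tau \<alpha> \<le> 0" by simp
    then show ?thesis using r(1) lam_pos[of \<alpha>] by (simp add: mult_le_0_iff divide_le_0_iff)
  qed
  show "0 \<le> tau \<alpha>" if z: "z \<in> side q lam tau \<alpha>"
  proof -
    define r where "r = min e (Re z - lft q lam \<alpha>)"
    have r: "0 < r" "r \<le> e" "r \<le> Re z - lft q lam \<alpha>"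
      using bot_side_interior[OF z assms(2)] e(1) by (auto simp: r_def)
    have "z - of_real r \<in> polygon D" using e(2)[of r] r by simp
    then have "lower (Re z - r) \<le> Im z" by (simp add: polygon_iff)
    also have "lower (Re z - r) = lft q tau \<alpha> + (Re z - r - lft q lam \<alpha>) / lam \<alpha> * tau \<alpha>"
      using r z by (intro bot.graph_height_on) (auto simp: bot_side_iff)
    also have "\<dots> = Im z - r / lam \<alpha> * tau \<alpha>"
      using z lam_pos[of \<alpha>] by (simp add: bot_side_iff field_simps)
    finally have "0 \<le> r / lam \<alpha> * tau \<alpha>" by simp
    then show ?thesis using r(1) lam_pos[of \<alpha>] by (simp add: zero_le_mult_iff zero_le_divide_iff)
  qed
qed

lemma crossing_nonvertex_params:
  assumes "crossing \<alpha> z z'" "z \<notin> vertices"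
  obtains \<theta> where "0 < \<theta>" "\<theta> < 1" "Im z = lft p tau \<alpha> + \<theta> * tau \<alpha>" "Im z' = lft q tau \<alpha> + \<theta> * tau \<alpha>"
proof -
  have z: "z \<in> side p lam tau \<alpha>" "z' \<in> side q lam tau \<alpha>"
    "Re z' - lft q lam \<alpha> = Re z - lft p lam \<alpha>" using assms(1) by (auto simp: crossing_def)
  note i = top_side_interior[OF z(1) assms(2)]
  show ?thesis
    by (rule that[of "(Re z - lft p lam \<alpha>) / lam \<alpha>"])
      (use i z lam_pos[of \<alpha>] in \<open>auto simp: top_side_iff bot_side_iff rgt_def\<close>)
qed

lemma convex_nonneg: "0 \<le> a \<Longrightarrow> 0 \<le> a + b \<Longrightarrow> 0 \<le> \<theta> \<Longrightarrow> \<theta> \<le> 1 \<Longrightarrow> 0 \<le> a + \<theta> * (b::real)"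
  by (smt (verit) mult_left_le_one_le mult_nonneg_nonneg mult_le_cancel_right1 mult_minus_right)

text \<open>
  If \<open>z\<close> is on or above the axis, both \<open>z\<close> and its partner have state \<open>(\<alpha>, Im z)\<close>. Otherwise
  \<open>\<alpha>\<close> is the last top letter and its side has descended below the axis. The partner then has
  negative height in rectangle \<open>\<alpha>\<close>, and \<open>carry\<close> moves it to the last bottom letter. This state is
  reached from that of \<open>z\<close> by sliding to the end of the bottom order: to the right of \<open>z\<close> the
  bottom line stays below the descending side \<open>\<alpha>\<close>, hence below \<open>z\<close>.
\<close>

lemma leave_through_top:
  assumes c: "crossing \<alpha> z z'" and nv: "z \<notin> vertices" and e: "entered z" and a: "located z a"
  shows "\<exists>b. located z' b \<and> hop\<^sup>*\<^sup>* (carry a) (carry b)"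
proof -
  have z: "z \<in> side p lam tau \<alpha>" "z' \<in> side q lam tau \<alpha>" "Im z' = Im z - roof \<alpha>"
    using c by (auto simp: crossing_def)
  have nv': "z' \<notin> vertices" using crossing_vertex[OF c] nv by simp
  have t0: "tau \<alpha> \<le> 0" by (rule entered_slope(1)[OF e nv z(1)])
  obtain \<theta> where th: "0 < \<theta>" "\<theta> < 1" "Im z = lft p tau \<alpha> + \<theta> * tau \<alpha>" "Im z' = lft q tau \<alpha> + \<theta> * tau \<alpha>"
    by (rule crossing_nonvertex_params[OF c nv])
  have th0: "\<theta> * tau \<alpha> \<le> 0" using th t0 by (simp add: mult_nonneg_nonpos)
  have neg: "Im z' < 0"
  proof (cases "q \<alpha> = 1")
    case True
    then have "tau \<alpha> < 0"
      using below[of \<alpha>] two lft_first[OF ord_q True, of tau] by (simp add: rgt_def)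
    then show ?thesis using th lft_q(2)[of \<alpha>] by (smt (verit) mult_pos_neg)
  next
    case False
    then show ?thesis using th0 th(4) lft_q(1)[OF False] by simp
  qed
  have iz: "lft p lam \<alpha> < Re z" "Re z < rgt p lam \<alpha>" using top_side_interior[OF z(1) nv] by auto
  have iz': "lft q lam \<alpha> < Re z'" "Re z' < rgt q lam \<alpha>" using bot_side_interior[OF z(2) nv'] by auto
  have b: "located z' (\<alpha>, Im z)" using neg iz' z(3) by (simp add: located_def)
  obtain \<beta> y where ay: "a = (\<beta>, y)" by (metis surj_pair)
  show ?thesis
  proof (cases "0 \<le> Im z")
    case True
    then have "lft p lam \<beta> \<le> Re z" "Re z < rgt p lam \<beta>" "y = Im z" using a by (auto simp: ay located_def)
    then have "\<beta> = \<alpha>" using top.letter_unique[OF iz, of \<beta>] by simp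
    then show ?thesis using b \<open>y = Im z\<close> ay by blast
  next
    case False
    have "\<alpha> = last_top"
    proof (rule ccontr)
      assume "\<alpha> \<noteq> last_top"
      then have "0 < rgt p tau \<alpha>" by (rule rgt_p_pos)
      then show False
        using convex_nonneg[of "lft p tau \<alpha>" "tau \<alpha>" \<theta>] lft_p(2)[of \<alpha>] th False by (simp add: rgt_def)
    qed
    have al: "lft q lam \<beta> \<le> Re z" "Re z < rgt q lam \<beta>" "y = Im z + roof \<beta>"
      using a False by (auto simp: ay located_def)
    have "hop\<^sup>*\<^sup>* (carry (\<beta>, Im z + roof \<beta>)) (carry (last_bot, Im z + roof last_bot))"
    proof (rule slide_over[OF al(2), of last_bot "max (Re z) (lft q lam last_bot)"])
      show "q \<beta> \<le> q last_bot" using enumeration_bounds(2)[OF ord_q, of \<beta>] last_bot_iff[of last_bot] by simp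
      fix \<gamma> assume g: "Re z < rgt q lam \<gamma>" "rgt q lam \<gamma> \<le> max (Re z) (lft q lam last_bot)"
      have gw: "rgt q lam \<gamma> < width"
        using g bot.lft_less_rgt[of last_bot] by (simp add: rgt_last_bot)
      have "rgt q tau \<gamma> < upper (rgt q lam \<gamma>)"
        using lower_less_upper[OF bot.rgt_pos gw] bot.graph_height_rgt[of tau \<gamma>] by simp
      also have "\<dots> = lft p tau \<alpha> + (rgt q lam \<gamma> - lft p lam \<alpha>) / lam \<alpha> * tau \<alpha>"
        using g gw iz \<open>\<alpha> = last_top\<close> rgt_last_top by (intro top.graph_height_on) auto
      also have "\<dots> \<le> lft p tau \<alpha> + (Re z - lft p lam \<alpha>) / lam \<alpha> * tau \<alpha>"
        using g t0 lam_pos[of \<alpha>] by (intro add_left_mono mult_right_mono_neg divide_right_mono) auto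
      also have "\<dots> = Im z" using z(1) by (simp add: top_side_iff)
      finally show "rgt q tau \<gamma> < Im z" .
    qed (use False in auto)
    also have "carry (last_bot, Im z + roof last_bot) = carry (\<alpha>, Im z)"
      using False \<open>\<alpha> = last_top\<close> last_neq by (auto simp: carry_def)
    finally show ?thesis using b ay al(3) by blast
  qed
qed

text \<open>
  As before, with the last bottom side, which may have risen above the axis.
\<close>

lemma leave_through_bottom:
  assumes c: "crossing \<alpha> z' z" and nv: "z \<notin> vertices" and e: "entered z" and a: "located z a"
  shows "\<exists>b. located z' b \<and> hop\<^sup>*\<^sup>* (carry a) (carry b)"
proof -
  have z: "z' \<in> side p lam tau \<alpha>" "z \<in> side q lam tau \<alpha>" "Im z = Im z' - roof \<alpha>"
    using c by (auto simp: crossing_def)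
  have nv': "z' \<notin> vertices" using crossing_vertex[OF c] nv by simp
  have t0: "0 \<le> tau \<alpha>" by (rule entered_slope(2)[OF e nv z(2)])
  obtain \<theta> where th: "0 < \<theta>" "\<theta> < 1" "Im z' = lft p tau \<alpha> + \<theta> * tau \<alpha>" "Im z = lft q tau \<alpha> + \<theta> * tau \<alpha>"
    by (rule crossing_nonvertex_params[OF c nv'])
  have "0 \<le> \<theta> * tau \<alpha>" using th t0 by simp
  then have pos: "0 \<le> Im z'" using th(3) lft_p(2)[of \<alpha>] by simp
  have iz': "lft p lam \<alpha> < Re z'" "Re z' < rgt p lam \<alpha>" using top_side_interior[OF z(1) nv'] by auto
  have iz: "lft q lam \<alpha> < Re z" "Re z < rgt q lam \<alpha>" using bot_side_interior[OF z(2) nv] by auto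
  have b: "located z' (\<alpha>, Im z + roof \<alpha>)" using pos iz' z(3) by (simp add: located_def)
  obtain \<beta> y where ay: "a = (\<beta>, y)" by (metis surj_pair)
  show ?thesis
  proof (cases "0 \<le> Im z")
    case False
    then have "lft q lam \<beta> \<le> Re z" "Re z < rgt q lam \<beta>" "y = Im z + roof \<beta>"
      using a by (auto simp: ay located_def)
    moreover from this have "\<beta> = \<alpha>" using bot.letter_unique[OF iz, of \<beta>] by simp
    ultimately show ?thesis using b ay by blast
  next
    case True
    have "\<alpha> = last_bot"
    proof (rule ccontr)
      assume "\<alpha> \<noteq> last_bot"
      then have "rgt q tau \<alpha> < 0" by (rule rgt_q_neg)
      moreover have "lft q tau \<alpha> + \<theta> * tau \<alpha> \<le> rgt q tau \<alpha>"
        using th t0 by (simp add: rgt_def mult_left_le_one_le)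
      ultimately show False using th True by simp
    qed
    have al: "lft p lam \<beta> \<le> Re z" "Re z < rgt p lam \<beta>" "y = Im z"
      using a True by (auto simp: ay located_def)
    have "hop\<^sup>*\<^sup>* (carry (\<beta>, Im z)) (carry (last_top, Im z))"
    proof (rule slide_under[OF al(2), of last_top "max (Re z) (lft p lam last_top)"])
      show "p \<beta> \<le> p last_top" using enumeration_bounds(2)[OF ord_p, of \<beta>] last_top_iff[of last_top] by simp
      fix \<gamma> assume g: "Re z < rgt p lam \<gamma>" "rgt p lam \<gamma> \<le> max (Re z) (lft p lam last_top)"
      have gw: "rgt p lam \<gamma> < width"
        using g top.lft_less_rgt[of last_top] by (simp add: rgt_last_top)
      have "Im z = lft q tau \<alpha> + (Re z - lft q lam \<alpha>) / lam \<alpha> * tau \<alpha>"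
        using z(2) by (simp add: bot_side_iff)
      also have "\<dots> \<le> lft q tau \<alpha> + (rgt p lam \<gamma> - lft q lam \<alpha>) / lam \<alpha> * tau \<alpha>"
        using g t0 lam_pos[of \<alpha>] by (intro add_left_mono mult_right_mono divide_right_mono) auto
      also have "\<dots> = lower (rgt p lam \<gamma>)"
        using g gw iz \<open>\<alpha> = last_bot\<close> rgt_last_bot by (intro bot.graph_height_on[symmetric]) auto
      also have "\<dots> < rgt p tau \<gamma>"
        using lower_less_upper[OF top.rgt_pos gw] top.graph_height_rgt[of tau \<gamma>] by simp
      finally show "Im z < rgt p tau \<gamma>" .
    qed (use True in auto)
    also have "carry (last_top, Im z) = carry (\<alpha>, Im z + roof \<alpha>)"
      using True \<open>\<alpha> = last_bot\<close> last_neq by (auto simp: carry_def)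
    finally show ?thesis using b ay al(3) by blast
  qed
qed

lemma change_representative:
  assumes "(z, z') \<in> glued D" "z \<notin> vertices" "entered z" "located z a"
  shows "\<exists>b. located z' b \<and> hop\<^sup>*\<^sup>* (carry a) (carry b)"
  using glued_nonvertex[OF assms(1,2)] leave_through_top[OF _ assms(2-4)]
    leave_through_bottom[OF _ assms(2-4)] assms(4) by blast

end

context simple_suspension
begin

section \<open>Starting and ending at a vertex\<close>

lemma start_reached: "lft p tau \<alpha> < roof \<alpha> \<Longrightarrow> reached (carry (\<alpha>, lft p tau \<alpha>))"
  using carry_id[of "lft p tau \<alpha>" \<alpha>] lft_p(2)[of \<alpha>] trajectory.start[of \<alpha>] by (auto simp: reached_def)

lemma rgt_less_width_iff:
  "rgt p lam \<gamma> < width \<longleftrightarrow> p \<gamma> < CARD('a)" "rgt q lam \<gamma> < width \<longleftrightarrow> q \<gamma> < CARD('a)"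
proof -
  show "rgt p lam \<gamma> < width \<longleftrightarrow> p \<gamma> < CARD('a)"
  proof (cases "p \<gamma> = CARD('a)")
    case False
    then have "p \<gamma> < CARD('a)" using enumeration_bounds(2)[OF ord_p, of \<gamma>] by simp
    moreover from this obtain \<delta> where d: "p \<delta> = Suc (p \<gamma>)" by (rule enumeration_succ[OF ord_p])
    have "rgt p lam \<gamma> < width"
      using top.lft_less_rgt[of \<delta>] top.rgt_le_total[of \<delta>] lft_succ[OF ord_p d, of lam] by simp
    ultimately show ?thesis by simp
  qed (simp add: rgt_last[OF ord_p])
  show "rgt q lam \<gamma> < width \<longleftrightarrow> q \<gamma> < CARD('a)"
  proof (cases "q \<gamma> = CARD('a)")
    case False
    then have "q \<gamma> < CARD('a)" using enumeration_bounds(2)[OF ord_q, of \<gamma>] by simp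
    moreover from this obtain \<delta> where d: "q \<delta> = Suc (q \<gamma>)" by (rule enumeration_succ[OF ord_q])
    have "rgt q lam \<gamma> < width"
      using bot.lft_less_rgt[of \<delta>] bot.rgt_le_total[of \<delta>] lft_succ[OF ord_q d, of lam] by simp
    ultimately show ?thesis by simp
  qed (simp add: rgt_last[OF ord_q])
qed

text \<open>
  A vertex of the top line starts a trajectory in the letter to its right. If that letter were
  first in the bottom order, its side would descend and leave no room for a flow line to the
  right of the vertex.
\<close>

lemma start_at_vertex:
  assumes v: "z \<in> vertices" and s: "0 < s" and P: "\<And>r. 0 \<le> r \<Longrightarrow> r \<le> s \<Longrightarrow> z + of_real r \<in> polygon D"
  shows "\<exists>a. located z a \<and> reached (carry a)"
proof -
  have w: "Re z < width" using P[of s] s by (simp add: polygon_iff)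
  consider "z = 0" | \<gamma> where "z = Complex (rgt p lam \<gamma>) (rgt p tau \<gamma>)"
    | \<gamma> where "z = Complex (rgt q lam \<gamma>) (rgt q tau \<gamma>)" using v unfolding vertices_def by auto
  then show ?thesis
  proof cases
    case 1
    obtain \<alpha> where a: "p \<alpha> = 1" using first_last_ex by blast
    then have l: "lft p tau \<alpha> = 0" "lft p lam \<alpha> = 0" using lft_first[OF ord_p a] by auto
    have "located z (\<alpha>, lft p tau \<alpha>)" using 1 l top.lft_less_rgt[of \<alpha>] by (simp add: located_def)
    then show ?thesis using start_reached[of \<alpha>] roof_pos[of \<alpha>] l by auto
  next
    case (2 \<gamma>)
    then have "p \<gamma> < CARD('a)" using w rgt_less_width_iff(1)[of \<gamma>] by simp
    then obtain \<delta> where d: "p \<delta> = Suc (p \<gamma>)" by (rule enumeration_succ[OF ord_p])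
    have z: "Re z = lft p lam \<delta>" "Im z = lft p tau \<delta>" using 2 by (auto simp: lft_succ[OF ord_p d])
    have "located z (\<delta>, lft p tau \<delta>)" using z lft_p(2)[of \<delta>] top.lft_less_rgt[of \<delta>] by (simp add: located_def)
    moreover have "q \<delta> \<noteq> 1"
    proof
      assume q1: "q \<delta> = 1"
      then have neg: "tau \<delta> < 0"
        using below[of \<delta>] two lft_first[OF ord_q q1, of tau] by (simp add: rgt_def)
      define r where "r = min s (lam \<delta>)"
      have r: "0 < r" "r \<le> s" "r \<le> lam \<delta>" using s lam_pos[of \<delta>] by (auto simp: r_def)
      have "Im z \<le> upper (Re z + r)" using P[of r] r by (simp add: polygon_iff)
      also have "\<dots> = lft p tau \<delta> + (Re z + r - lft p lam \<delta>) / lam \<delta> * tau \<delta>"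
        using r z by (intro top.graph_height_on) (auto simp: rgt_def)
      finally have "0 \<le> r / lam \<delta> * tau \<delta>" using z by simp
      moreover have "r / lam \<delta> * tau \<delta> < 0" by (rule mult_pos_neg[OF divide_pos_pos[OF r(1) lam_pos] neg])
      ultimately show False by simp
    qed
    then have "lft p tau \<delta> < roof \<delta>" using lft_q(1)[of \<delta>] by (simp add: roof_def)
    ultimately show ?thesis using start_reached by blast
  next
    case (3 \<gamma>)
    then have "q \<gamma> < CARD('a)" using w rgt_less_width_iff(2)[of \<gamma>] by simp
    then obtain \<delta> where d: "q \<delta> = Suc (q \<gamma>)" by (rule enumeration_succ[OF ord_q])
    have z: "Re z = lft q lam \<delta>" "Im z = lft q tau \<delta>" using 3 by (auto simp: lft_succ[OF ord_q d])
    have neg: "lft q tau \<delta> < 0" using below[of \<gamma>] \<open>q \<gamma> < _\<close> by (simp add: lft_succ[OF ord_q d])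
    have "located z (\<delta>, lft p tau \<delta>)"
      using z neg bot.lft_less_rgt[of \<delta>] by (simp add: located_def roof_def)
    moreover have "lft p tau \<delta> < roof \<delta>" using neg by (simp add: roof_def)
    ultimately show ?thesis using start_reached by blast
  qed
qed

lemma reached_saddle:
  assumes "reached (\<alpha>, rgt p tau \<alpha>)"
  shows "\<exists>as. saddle as"
  using assms by (auto simp: reached_def saddle_def)

text \<open>
  The segment is followed as far as the letter that ends at the vertex, where the height of the
  line is by definition that of the singularity. The common right end of both broken lines is
  treated as a vertex of the top line if it is on or above the axis, and as one of the bottom line
  otherwise.
\<close>

lemma end_at_vertex:
  assumes v: "z + of_real s \<in> vertices" and s: "0 < s"
    and P: "\<And>r. 0 \<le> r \<Longrightarrow> r \<le> s \<Longrightarrow> z + of_real r \<in> polygon D"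
    and nv: "\<And>r. 0 < r \<Longrightarrow> r < s \<Longrightarrow> z + of_real r \<notin> vertices"
    and a: "located z a" "reached (carry a)"
  shows "\<exists>as. saddle as"
proof -
  obtain \<alpha> y where ay: "a = (\<alpha>, y)" by (metis surj_pair)
  have cross: "Re z < rgt p lam \<gamma> \<Longrightarrow> rgt p lam \<gamma> \<le> x' \<Longrightarrow> Im z < rgt p tau \<gamma>"
    "Re z < rgt q lam \<gamma> \<Longrightarrow> rgt q lam \<gamma> \<le> x' \<Longrightarrow> rgt q tau \<gamma> < Im z" if "x' < Re z + s" for x' \<gamma>
    using segment_crossings[of s z x' \<gamma>, OF P nv] that by auto
  have top_end: ?thesis if z: "Re z + s = rgt p lam \<gamma>" "Im z = rgt p tau \<gamma>" "0 \<le> Im z" for \<gamma>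
  proof -
    have al: "lft p lam \<alpha> \<le> Re z" "Re z < rgt p lam \<alpha>" "y = Im z"
      using a z by (auto simp: located_def ay)
    have x': "max (Re z) (lft p lam \<gamma>) < Re z + s" using s z top.lft_less_rgt[of \<gamma>] by simp
    have "hop\<^sup>*\<^sup>* (carry (\<alpha>, Im z)) (carry (\<gamma>, Im z))"
    proof (rule slide_under[OF al(2) _ _ z(3) cross(1)[OF x']])
      show "p \<alpha> \<le> p \<gamma>" by (rule top.order_of_overlap) (use al z s in linarith)
    qed auto
    then have "reached (carry (\<gamma>, rgt p tau \<gamma>))" using reached_hops a al z(2) by (auto simp: ay)
    moreover have "carry (\<gamma>, rgt p tau \<gamma>) = (\<gamma>, rgt p tau \<gamma>)
      \<or> carry (\<gamma>, rgt p tau \<gamma>) = (last_top, rgt p tau last_top)"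
      using z(2,3) height_last_bot by (auto simp: carry_def rgt_last_top)
    ultimately show ?thesis using reached_saddle by auto
  qed
  have bot_end: ?thesis if z: "Re z + s = rgt q lam \<gamma>" "Im z = rgt q tau \<gamma>" "Im z < 0" for \<gamma>
  proof -
    have al: "lft q lam \<alpha> \<le> Re z" "Re z < rgt q lam \<alpha>" "y = Im z + roof \<alpha>"
      using a z by (auto simp: located_def ay)
    have x': "max (Re z) (lft q lam \<gamma>) < Re z + s" using s z bot.lft_less_rgt[of \<gamma>] by simp
    have "hop\<^sup>*\<^sup>* (carry (\<alpha>, Im z + roof \<alpha>)) (carry (\<gamma>, Im z + roof \<gamma>))"
    proof (rule slide_over[OF al(2) _ _ z(3) cross(2)[OF x']])
      show "q \<alpha> \<le> q \<gamma>" by (rule bot.order_of_overlap) (use al z s in linarith)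
    qed auto
    moreover have "Im z + roof \<gamma> = rgt p tau \<gamma>" using z(2) by (simp add: roof_rgt)
    ultimately have "reached (carry (\<gamma>, rgt p tau \<gamma>))" using reached_hops a al by (auto simp: ay)
    moreover have "carry (\<gamma>, rgt p tau \<gamma>) = (\<gamma>, rgt p tau \<gamma>)
      \<or> carry (\<gamma>, rgt p tau \<gamma>) = (last_bot, rgt p tau last_bot)"
      using z(2,3) height_last_bot roof_rgt[of \<gamma>] last_neq by (auto simp: carry_def rgt_last_top)
    ultimately show ?thesis using reached_saddle by auto
  qed
  have "0 \<le> Re z" using P[of 0] s by (simp add: polygon_iff)
  then have "z + of_real s \<noteq> 0" using s by (auto simp: complex_eq_iff)
  then consider \<gamma> where "Re z + s = rgt p lam \<gamma>" "Im z = rgt p tau \<gamma>"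
    | \<gamma> where "Re z + s = rgt q lam \<gamma>" "Im z = rgt q tau \<gamma>"
    using v unfolding vertices_def by (auto simp: complex_eq_iff)
  then show ?thesis
  proof cases
    case (1 \<gamma>)
    show ?thesis
    proof (cases "0 \<le> Im z")
      case False
      then have "\<gamma> = last_top" using rgt_p_pos[of \<gamma>] 1 by force
      then show ?thesis using bot_end[of last_bot] 1 False by (simp add: rgt_last_top rgt_last_bot)
    qed (use top_end 1 in blast)
  next
    case (2 \<gamma>)
    show ?thesis
    proof (cases "0 \<le> Im z")
      case True
      then have "\<gamma> = last_bot" using rgt_q_neg[of \<gamma>] 2 by force
      then show ?thesis using top_end[of last_top] 2 True by (simp add: rgt_last_top rgt_last_bot)
    qed (use bot_end 2 in force)
  qed
qed

section \<open>Following a flow line\<close>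

text \<open>
  The property that is carried along a flow line: it came from a singularity and its coding up to
  now is a trajectory.
\<close>

definition tracked :: "complex set \<Rightarrow> bool" where
  "tracked c \<longleftrightarrow> (\<exists>z\<in>c. entered z \<and> (\<exists>a. located z a \<and> reached (carry a)))"

lemma surface_point_refl: "z \<in> surface_point D z"
  by (simp add: surface_point_def glued_def)

lemma tracked_representative:
  assumes "tracked (surface_point D z)" "z \<notin> vertices"
  shows "\<exists>a. located z a \<and> reached (carry a)"
proof -
  obtain z1 a where z1: "(z, z1) \<in> glued D" "entered z1" "located z1 a" "reached (carry a)"
    using assms(1) by (auto simp: tracked_def surface_point_def)
  have "z1 \<notin> vertices" using glued_vertex[OF z1(1)] assms(2) by simp
  from change_representative[OF glued_sym[OF z1(1)] this z1(2,3)] show ?thesis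
    using reached_hops z1(4) by blast
qed

lemma tracked_segment:
  assumes "0 < s" and P: "\<And>r. 0 \<le> r \<Longrightarrow> r \<le> s \<Longrightarrow> z + of_real r \<in> polygon D"
    and nv: "\<And>r. 0 < r \<Longrightarrow> r \<le> s \<Longrightarrow> z + of_real r \<notin> vertices"
    and a: "located z a" "reached (carry a)"
  shows "tracked (surface_point D (z + of_real s))"
proof -
  obtain b where "located (z + of_real s) b" "hop\<^sup>*\<^sup>* (carry a) (carry b)"
    using slide_segment[OF assms(1) P nv a(1)] by blast
  moreover have "entered (z + of_real s)"
    unfolding entered_def
  proof (intro exI[of _ s] conjI ballI assms(1))
    fix r assume "r \<in> {0..s}"
    then show "z + of_real s - of_real r \<in> polygon D" using P[of "s - r"] by (simp add: algebra_simps)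
  qed
  ultimately show ?thesis
    using reached_hops a(2) surface_point_refl unfolding tracked_def by blast
qed

definition regular :: "(real \<Rightarrow> complex set) \<Rightarrow> real \<Rightarrow> real \<Rightarrow> bool" where
  "regular \<gamma> a b \<longleftrightarrow> (\<forall>t\<in>{a..b}. \<gamma> t \<notin> singularities D)"

lemma regularD: "regular \<gamma> a b \<Longrightarrow> a \<le> t \<Longrightarrow> t \<le> b \<Longrightarrow> \<gamma> t \<notin> singularities D"
  by (simp add: regular_def)

lemma horizontal_lineD:
  assumes "horizontal_line D \<gamma> T"
  shows "0 \<le> t \<Longrightarrow> t < T \<Longrightarrow> \<exists>z \<epsilon>. 0 < \<epsilon> \<and> (\<forall>s. 0 \<le> s \<longrightarrow> s \<le> \<epsilon> \<longrightarrow>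
        z + of_real s \<in> polygon D \<and> \<gamma> (t + s) = surface_point D (z + of_real s))"
    "0 < t \<Longrightarrow> t \<le> T \<Longrightarrow> \<exists>z \<epsilon>. 0 < \<epsilon> \<and> (\<forall>s. 0 \<le> s \<longrightarrow> s \<le> \<epsilon> \<longrightarrow>
        z - of_real s \<in> polygon D \<and> \<gamma> (t - s) = surface_point D (z - of_real s))"
proof -
  show "\<exists>z \<epsilon>. 0 < \<epsilon> \<and> (\<forall>s. 0 \<le> s \<longrightarrow> s \<le> \<epsilon> \<longrightarrow>
        z + of_real s \<in> polygon D \<and> \<gamma> (t + s) = surface_point D (z + of_real s))" if "0 \<le> t" "t < T"
  proof -
    have "t \<in> {0..<T}" using that by simp
    then obtain z e where "0 < e" "\<forall>s\<in>{0..e}.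
        z + of_real s \<in> polygon D \<and> \<gamma> (t + s) = surface_point D (z + of_real s)"
      using assms unfolding horizontal_line_def by blast
    then show ?thesis by (intro exI[of _ z] exI[of _ e]) simp
  qed
  show "\<exists>z \<epsilon>. 0 < \<epsilon> \<and> (\<forall>s. 0 \<le> s \<longrightarrow> s \<le> \<epsilon> \<longrightarrow>
        z - of_real s \<in> polygon D \<and> \<gamma> (t - s) = surface_point D (z - of_real s))" if "0 < t" "t \<le> T"
  proof -
    have "t \<in> {0<..T}" using that by simp
    then obtain z e where "0 < e" "\<forall>s\<in>{0..e}.
        z - of_real s \<in> polygon D \<and> \<gamma> (t - s) = surface_point D (z - of_real s)"
      using assms unfolding horizontal_line_def by blast
    then show ?thesis by (intro exI[of _ z] exI[of _ e]) simp
  qed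
qed

lemma tracked_after:
  assumes h: "horizontal_line D \<gamma> T" and "0 \<le> t" "t < T"
  shows "\<exists>\<epsilon>>0. \<forall>s. 0 \<le> s \<longrightarrow> s \<le> \<epsilon> \<longrightarrow> regular \<gamma> t (t + s) \<longrightarrow> tracked (\<gamma> t) \<longrightarrow> tracked (\<gamma> (t + s))"
proof -
  obtain z e where e: "0 < e" and P: "\<And>s. 0 \<le> s \<Longrightarrow> s \<le> e \<Longrightarrow> z + of_real s \<in> polygon D"
    and g: "\<And>s. 0 \<le> s \<Longrightarrow> s \<le> e \<Longrightarrow> \<gamma> (t + s) = surface_point D (z + of_real s)"
    using horizontal_lineD(1)[OF assms] by blast
  have "tracked (\<gamma> (t + s))" if s: "0 \<le> s" "s \<le> e" "regular \<gamma> t (t + s)" "tracked (\<gamma> t)" for s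
  proof (cases "s = 0")
    case False
    have nv: "z + of_real r \<notin> vertices" if "0 \<le> r" "r \<le> s" for r
      using regularD[OF s(3), of "t + r"] that s(2) g[of r] surface_point_singular[of "z + of_real r"]
      by simp
    have "tracked (surface_point D z)" using s(4) g[of 0] e by simp
    then obtain a where "located z a" "reached (carry a)"
      using tracked_representative[of z] nv[of 0] s by auto
    then have "tracked (surface_point D (z + of_real s))"
      using s False by (intro tracked_segment[of s z a] P nv) auto
    then show ?thesis using g[of s] s by simp
  qed (use s in simp)
  then show ?thesis using e by blast
qed

lemma tracked_before:
  assumes h: "horizontal_line D \<gamma> T" and "0 < t" "t \<le> T"
  shows "\<exists>\<epsilon>>0. \<forall>s. 0 \<le> s \<longrightarrow> s \<le> \<epsilon> \<longrightarrow> regular \<gamma> (t - s) t \<longrightarrow> tracked (\<gamma> (t - s)) \<longrightarrow> tracked (\<gamma> t)"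
proof -
  obtain z e where e: "0 < e" and P: "\<And>s. 0 \<le> s \<Longrightarrow> s \<le> e \<Longrightarrow> z - of_real s \<in> polygon D"
    and g: "\<And>s. 0 \<le> s \<Longrightarrow> s \<le> e \<Longrightarrow> \<gamma> (t - s) = surface_point D (z - of_real s)"
    using horizontal_lineD(2)[OF assms] by blast
  have "tracked (\<gamma> t)" if s: "0 \<le> s" "s \<le> e" "regular \<gamma> (t - s) t" "tracked (\<gamma> (t - s))" for s
  proof (cases "s = 0")
    case False
    let ?z = "z - of_real s"
    have sh: "?z + of_real r = z - of_real (s - r)" for r by (simp add: algebra_simps)
    have nv: "?z + of_real r \<notin> vertices" if "0 \<le> r" "r \<le> s" for r
      using regularD[OF s(3), of "t - (s - r)"] that s(2) g[of "s - r"]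
        surface_point_singular[of "?z + of_real r"] unfolding sh by auto
    have "tracked (surface_point D ?z)" using s(4) g[of s] s by simp
    then obtain a where "located ?z a" "reached (carry a)"
      using tracked_representative[of ?z] nv[of 0] s by auto
    moreover have "?z + of_real r \<in> polygon D" if "0 \<le> r" "r \<le> s" for r
      unfolding sh using P[of "s - r"] that s(2) by simp
    ultimately have "tracked (surface_point D (?z + of_real s))"
      using s(1) False nv by (intro tracked_segment[of s ?z a]) simp_all
    then show ?thesis using g[of 0] e by simp
  qed (use s in simp)
  then show ?thesis using e by blast
qed

text \<open>
  At every time the flow line is a segment of the polygon just before and just after, in possibly
  different representatives. Bisection turns these local statements into one for the whole line.
\<close>

lemma tracked_along:
  assumes h: "horizontal_line D \<gamma> T" and ab: "0 \<le> a" "a \<le> b" "b \<le> T"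
    and r: "regular \<gamma> a b" and t: "tracked (\<gamma> a)"
  shows "tracked (\<gamma> b)"
proof -
  \<comment> \<open>the bounds on the times are part of the property, since bisection also tries times outside\<close>
  define Q where "Q = (\<lambda>u v. a \<le> u \<and> v \<le> b \<and> tracked (\<gamma> u) \<longrightarrow> tracked (\<gamma> v))"
  have reg: "regular \<gamma> u v" if "a \<le> u" "v \<le> b" for u v using r that by (auto simp: regular_def)
  have "Q a b"
    using ab(2)
  proof (induction rule: Bolzano)
    case (trans u v w)
    then show ?case by (auto simp: Q_def)
  next
    case (local x)
    have "\<exists>e>0. \<forall>v. x \<le> v \<and> v - x < e \<and> v \<le> b \<longrightarrow> tracked (\<gamma> x) \<longrightarrow> tracked (\<gamma> v)"
    proof (cases "x < T")
      case True
      then obtain e where e: "e > 0" "\<And>s. 0 \<le> s \<Longrightarrow> s \<le> e \<Longrightarrow> regular \<gamma> x (x + s) \<Longrightarrow>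
          tracked (\<gamma> x) \<Longrightarrow> tracked (\<gamma> (x + s))"
        using tracked_after[OF h, of x] local ab by auto
      have "tracked (\<gamma> v)" if "x \<le> v" "v - x < e" "v \<le> b" "tracked (\<gamma> x)" for v
        using e(2)[of "v - x"] reg[of x v] that local by simp
      then show ?thesis using e(1) by blast
    next
      case False
      then have "v = x" if "x \<le> v" "v \<le> b" for v using that ab by simp
      then show ?thesis by (intro exI[of _ 1]) auto
    qed
    then obtain e1 where e1: "e1 > 0"
      "\<And>v. x \<le> v \<Longrightarrow> v - x < e1 \<Longrightarrow> v \<le> b \<Longrightarrow> tracked (\<gamma> x) \<Longrightarrow> tracked (\<gamma> v)" by blast
    have "\<exists>e>0. \<forall>u. u \<le> x \<and> x - u < e \<and> a \<le> u \<longrightarrow> tracked (\<gamma> u) \<longrightarrow> tracked (\<gamma> x)"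
    proof (cases "0 < x")
      case True
      then obtain e where e: "e > 0" "\<And>s. 0 \<le> s \<Longrightarrow> s \<le> e \<Longrightarrow> regular \<gamma> (x - s) x \<Longrightarrow>
          tracked (\<gamma> (x - s)) \<Longrightarrow> tracked (\<gamma> x)"
        using tracked_before[OF h, of x] local ab by auto
      have "tracked (\<gamma> x)" if "u \<le> x" "x - u < e" "a \<le> u" "tracked (\<gamma> u)" for u
        using e(2)[of "x - u"] reg[of u x] that local by simp
      then show ?thesis using e(1) by blast
    next
      case False
      then have "u = x" if "u \<le> x" "a \<le> u" for u using that ab by simp
      then show ?thesis by (intro exI[of _ 1]) auto
    qed
    then obtain e2 where e2: "e2 > 0"
      "\<And>u. u \<le> x \<Longrightarrow> x - u < e2 \<Longrightarrow> a \<le> u \<Longrightarrow> tracked (\<gamma> u) \<Longrightarrow> tracked (\<gamma> x)" by blast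
    have "Q u v" if uv: "u \<le> x" "x \<le> v" "v - u < min e1 e2" for u v
      unfolding Q_def
    proof (intro impI, elim conjE)
      assume Q: "a \<le> u" "v \<le> b" "tracked (\<gamma> u)"
      have "tracked (\<gamma> x)" using e2(2)[of u] Q uv by simp
      then show "tracked (\<gamma> v)" using e1(2)[of v] Q uv by simp
    qed
    then show ?case using e1(1) e2(1) by (intro exI[of _ "min e1 e2"]) auto
  qed
  then show ?thesis using t by (simp add: Q_def)
qed

lemma tracked_rightward:
  assumes "on_rightward_separatrix D c"
  shows "tracked c"
proof -
  obtain \<gamma> T where T: "0 < T" and h: "horizontal_line D \<gamma> T" and s: "\<gamma> 0 \<in> singularities D"
    and ns: "\<And>t. 0 < t \<Longrightarrow> t \<le> T \<Longrightarrow> \<gamma> t \<notin> singularities D" and c: "\<gamma> T = c"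
    using assms unfolding on_rightward_separatrix_def by auto
  obtain z e where e: "0 < e" and P: "\<And>s. 0 \<le> s \<Longrightarrow> s \<le> e \<Longrightarrow> z + of_real s \<in> polygon D"
    and g: "\<And>s. 0 \<le> s \<Longrightarrow> s \<le> e \<Longrightarrow> \<gamma> s = surface_point D (z + of_real s)"
    using horizontal_lineD(1)[OF h, of 0] T by auto
  have "z \<in> vertices" using s g[of 0] e surface_point_singular[of z] by simp
  then obtain a where a: "located z a" "reached (carry a)"
    using start_at_vertex[OF _ e] P by blast
  let ?r = "min e T"
  have r: "0 < ?r" "?r \<le> e" "?r \<le> T" using e T by auto
  have "tracked (surface_point D (z + of_real ?r))"
  proof (rule tracked_segment[OF r(1) _ _ a])
    fix s assume "0 < s" "s \<le> ?r"
    then show "z + of_real s \<notin> vertices" using ns[of s] g[of s] surface_point_singular[of "z + of_real s"] by simp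
  qed (use P in auto)
  then have "tracked (\<gamma> ?r)" using g[of ?r] r by simp
  moreover have "regular \<gamma> ?r T" unfolding regular_def
  proof
    fix t assume "t \<in> {?r..T}"
    then have "0 < t" "t \<le> T" using r(1) by auto
    then show "\<gamma> t \<notin> singularities D" by (rule ns)
  qed
  ultimately have "tracked (\<gamma> T)"
    using r by (intro tracked_along[OF h, of ?r T]) simp_all
  then show ?thesis using c by simp
qed

lemma saddle_of_leftward:
  assumes "on_leftward_separatrix D c" "tracked c"
  shows "\<exists>as. saddle as"
proof -
  obtain \<gamma> T where T: "0 < T" and h: "horizontal_line D \<gamma> T" and s: "\<gamma> T \<in> singularities D"
    and ns: "\<And>t. 0 \<le> t \<Longrightarrow> t < T \<Longrightarrow> \<gamma> t \<notin> singularities D" and c: "\<gamma> 0 = c"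
    using assms(1) unfolding on_leftward_separatrix_def by auto
  obtain z e where e: "0 < e" and P: "\<And>s. 0 \<le> s \<Longrightarrow> s \<le> e \<Longrightarrow> z - of_real s \<in> polygon D"
    and g: "\<And>s. 0 \<le> s \<Longrightarrow> s \<le> e \<Longrightarrow> \<gamma> (T - s) = surface_point D (z - of_real s)"
    using horizontal_lineD(2)[OF h, of T] T by auto
  obtain \<rho> where r: "0 < \<rho>" "\<rho> \<le> e" "\<rho> \<le> T" using e T that[of "min e T"] by auto
  let ?z = "z - of_real \<rho>"
  have "regular \<gamma> 0 (T - \<rho>)" unfolding regular_def
  proof
    fix t assume "t \<in> {0..T - \<rho>}"
    then have "0 \<le> t" "t < T" using r(1) by auto
    then show "\<gamma> t \<notin> singularities D" by (rule ns)
  qed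
  moreover have "0 \<le> T - \<rho>" "T - \<rho> \<le> T" "tracked (\<gamma> 0)" using r assms(2) c by simp_all
  ultimately have "tracked (\<gamma> (T - \<rho>))" using tracked_along[OF h order_refl] by blast
  then have tr: "tracked (surface_point D ?z)" using g[of \<rho>] r by simp
  have sh: "?z + of_real s = z - of_real (\<rho> - s)" for s by (simp add: algebra_simps)
  have nv: "?z + of_real s \<notin> vertices" if "0 \<le> s" "s < \<rho>" for s
    using ns[of "T - (\<rho> - s)"] g[of "\<rho> - s"] surface_point_singular[of "?z + of_real s"] that r(2,3)
    unfolding sh by auto
  have "?z \<notin> vertices" using nv[of 0] r(1) by simp
  then obtain a where a: "located ?z a" "reached (carry a)"
    using tracked_representative[OF tr] by blast
  have "z \<in> vertices" using s g[of 0] e surface_point_singular[of z] by simp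
  then have "?z + of_real \<rho> \<in> vertices" by (simp only: diff_add_cancel)
  moreover have "?z + of_real s \<in> polygon D" if "0 \<le> s" "s \<le> \<rho>" for s
    unfolding sh using P[of "\<rho> - s"] that r(2) by simp
  ultimately show ?thesis using nv less_imp_le by (intro end_at_vertex[OF _ r(1) _ _ a]) blast+
qed

end

section \<open>Saddle connections obstruct completeness\<close>

theorem saddle_connection_coded:
  fixes D :: "'a::finite triple"
  assumes two: "2 \<le> CARD('a)" and "D \<in> admissible" "simple_polygon D" "polygon_saddle_connection D"
  shows "\<exists>as. coded_saddle D as"
proof -
  obtain p q lam tau where D: "D = ((p, q), lam, tau)" by (metis surj_pair)
  interpret simple_suspension p q tau lam
    using assms(2,3) unfolding D
    by (auto simp: admissible_iff[OF two] simple_suspension_def simple_suspension_axioms_def)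
  obtain c where "on_rightward_separatrix ((p, q), lam, tau) c" "on_leftward_separatrix ((p, q), lam, tau) c"
    using assms(4) unfolding D polygon_saddle_connection_def by blast
  then show ?thesis
    unfolding D coded_saddle_eq using tracked_rightward saddle_of_leftward by blast
qed

theorem theorem11:
  fixes \<pi> :: "'a::finite perm_pair" and lam tau :: "'a \<Rightarrow> real"
  assumes "CARD('a) \<ge> 2"
    and "\<pi> \<in> irreducible_perms"
    and "\<And>\<alpha>. lam \<alpha> > 0"
    and "tau \<in> Theta \<pi>"
    and "has_horizontal_saddle_connection (\<pi>, lam, tau)"
  shows "\<not> backward_infinity_complete (\<pi>, lam, tau)"
proof
  assume complete: "backward_infinity_complete (\<pi>, lam, tau)"
  have "(\<pi>, lam, tau) \<in> admissible" using assms(2-4) by (simp add: admissible_def)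
  moreover obtain E where "represented_by (\<pi>, lam, tau) E" and saddle: "polygon_saddle_connection E"
    using assms(5) unfolding has_horizontal_saddle_connection_def by blast
  ultimately have E: "simple_polygon E" "E \<in> admissible" "backward_infinity_complete E"
    using represented_by_transfer[OF _ assms(1)] complete by blast+
  then obtain as where "coded_saddle E as" using saddle_connection_coded[OF assms(1)] saddle by blast
  then show False using complete_no_saddle[OF assms(1)] E by blast
qed

end
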